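(* Let $m\ge1$ and let $C_m$ be the Catalan monoid, i.e. the monoid of all order-preserving and nondecreasing maps $f:\{1,\dots,m\}\to\{1,\dots,m\}$ ($x\le y\Rightarrow f(x)\le f(y)$, and $x\le f(x)$ for all $x$) under composition. Then for every algebraically closed field $k$, $kC_m$ satisfies the group-injective condition.
   Context: For a monoid $M$ with group of units $G$ and a $kG$-module $W$, $\mathrm{Ind}(W)$ is the $kM$-module with underlying space $W$ on which $G$ acts as given and $M\setminus G$ acts as $0$. Group-injective condition for $kM$: there is a projective indecomposable $kG$-module $P$ such that $\mathrm{Ind}(P)$ is an injective $kM$-module. (For $C_m$ the group of units is trivial.) *)

theory Defs
  imports "HOL-Algebra.Algebra" "HOL-Library.FuncSet"
begin

section \<open>Left modules over rings that need not be commutative\<close>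

text \<open>The locale \<^locale>\<open>module\<close> of the library requires a commutative ring. The following locale
  has the same axioms without commutativity, on the same record type.\<close>

locale left_module = R?: ring R + M?: abelian_group M
  for R :: "('r, 's) ring_scheme" (structure) and M :: "('r, 'w, 't) module_scheme" (structure) +
  assumes smult_closed [simp, intro]:
      "\<lbrakk>a \<in> carrier R; x \<in> carrier M\<rbrakk> \<Longrightarrow> a \<odot>\<^bsub>M\<^esub> x \<in> carrier M"
    and smult_l_distr:
      "\<lbrakk>a \<in> carrier R; b \<in> carrier R; x \<in> carrier M\<rbrakk> \<Longrightarrow>
      (a \<oplus> b) \<odot>\<^bsub>M\<^esub> x = a \<odot>\<^bsub>M\<^esub> x \<oplus>\<^bsub>M\<^esub> b \<odot>\<^bsub>M\<^esub> x"
    and smult_r_distr: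
      "\<lbrakk>a \<in> carrier R; x \<in> carrier M; y \<in> carrier M\<rbrakk> \<Longrightarrow>
      a \<odot>\<^bsub>M\<^esub> (x \<oplus>\<^bsub>M\<^esub> y) = a \<odot>\<^bsub>M\<^esub> x \<oplus>\<^bsub>M\<^esub> a \<odot>\<^bsub>M\<^esub> y"
    and smult_assoc1:
      "\<lbrakk>a \<in> carrier R; b \<in> carrier R; x \<in> carrier M\<rbrakk> \<Longrightarrow>
      (a \<otimes> b) \<odot>\<^bsub>M\<^esub> x = a \<odot>\<^bsub>M\<^esub> (b \<odot>\<^bsub>M\<^esub> x)"
    and smult_one [simp]:
      "x \<in> carrier M \<Longrightarrow> \<one> \<odot>\<^bsub>M\<^esub> x = x"
begin

lemma smult_l_null [simp]: "x \<in> carrier M \<Longrightarrow> \<zero> \<odot>\<^bsub>M\<^esub> x = \<zero>\<^bsub>M\<^esub>"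
  by (metis M.add.r_cancel_one' R.l_zero R.zero_closed smult_closed smult_l_distr)

lemma smult_r_null [simp]: "a \<in> carrier R \<Longrightarrow> a \<odot>\<^bsub>M\<^esub> \<zero>\<^bsub>M\<^esub> = \<zero>\<^bsub>M\<^esub>"
  by (metis M.add.r_cancel_one' M.l_zero M.zero_closed smult_closed smult_r_distr)

lemma smult_minus_one: "x \<in> carrier M \<Longrightarrow> (\<ominus> \<one>) \<odot>\<^bsub>M\<^esub> x = \<ominus>\<^bsub>M\<^esub> x"
  by (metis M.minus_equality R.add.inv_closed R.l_neg R.one_closed smult_closed smult_l_distr
      smult_l_null smult_one)

end

definition left_module_hom ::
  "('r, 's) ring_scheme \<Rightarrow> ('r, 'a, 't) module_scheme \<Rightarrow> ('r, 'b, 'u) module_scheme \<Rightarrow> ('a \<Rightarrow> 'b) set"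
  where "left_module_hom R A B =
    {h \<in> carrier A \<rightarrow> carrier B.
      (\<forall>x\<in>carrier A. \<forall>y\<in>carrier A. h (x \<oplus>\<^bsub>A\<^esub> y) = h x \<oplus>\<^bsub>B\<^esub> h y) \<and>
      (\<forall>r\<in>carrier R. \<forall>x\<in>carrier A. h (r \<odot>\<^bsub>A\<^esub> x) = r \<odot>\<^bsub>B\<^esub> h x)}"

text \<open>Injectivity and projectivity are the usual extension and lifting properties. The test modules
  \<open>A\<close> and \<open>B\<close> have to live on some types, which are passed as arguments; the lemmas
  \<open>injective_module_any_type\<close> and \<open>projective_module_any_type\<close> below show that the types
  of elements of \<open>R\<close>, respectively of functions from \<open>P\<close> to \<open>R\<close> and of elements of \<open>P\<close>,
  are large enough to imply the property for test modules on all types.\<close>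

definition injective_module ::
  "'a itself \<Rightarrow> 'b itself \<Rightarrow> ('r, 's) ring_scheme \<Rightarrow> ('r, 'w) module \<Rightarrow> bool"
  where "injective_module (\<alpha> :: 'a itself) (\<beta> :: 'b itself) R W \<longleftrightarrow>
    left_module R W \<and>
    (\<forall>(A :: ('r, 'a) module) (B :: ('r, 'b) module) i f.
      left_module R A \<and> left_module R B \<and>
      i \<in> left_module_hom R A B \<and> inj_on i (carrier A) \<and> f \<in> left_module_hom R A W \<longrightarrow>
      (\<exists>g \<in> left_module_hom R B W. \<forall>x\<in>carrier A. g (i x) = f x))"

definition projective_module ::
  "'a itself \<Rightarrow> 'b itself \<Rightarrow> ('r, 's) ring_scheme \<Rightarrow> ('r, 'p) module \<Rightarrow> bool"
  where "projective_module (\<alpha> :: 'a itself) (\<beta> :: 'b itself) R P \<longleftrightarrow>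
    left_module R P \<and>
    (\<forall>(A :: ('r, 'a) module) (B :: ('r, 'b) module) q f.
      left_module R A \<and> left_module R B \<and>
      q \<in> left_module_hom R A B \<and> q ` carrier A = carrier B \<and> f \<in> left_module_hom R P B \<longrightarrow>
      (\<exists>g \<in> left_module_hom R P A. \<forall>x\<in>carrier P. q (g x) = f x))"

definition indecomposable_module :: "('r, 's) ring_scheme \<Rightarrow> ('r, 'p) module \<Rightarrow> bool"
  where "indecomposable_module R P \<longleftrightarrow>
    left_module R P \<and> carrier P \<noteq> {\<zero>\<^bsub>P\<^esub>} \<and>
    (\<forall>A B. submodule A R P \<and> submodule B R P \<and>
       A \<inter> B = {\<zero>\<^bsub>P\<^esub>} \<and> A <+>\<^bsub>P\<^esub> B = carrier P \<longrightarrow> A = {\<zero>\<^bsub>P\<^esub>} \<or> B = {\<zero>\<^bsub>P\<^esub>})"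


section \<open>Monoid algebras and the group-injective condition\<close>

text \<open>Elements of the monoid algebra are finitely supported functions from the monoid to the
  coefficients, extended by zero outside the carrier of the monoid.\<close>

definition monoid_algebra ::
  "('k, 's) ring_scheme \<Rightarrow> ('m, 't) monoid_scheme \<Rightarrow> ('m \<Rightarrow> 'k) ring"
  where "monoid_algebra K M =
    \<lparr>carrier = {a \<in> UNIV \<rightarrow> carrier K. finite {x. a x \<noteq> \<zero>\<^bsub>K\<^esub>} \<and> {x. a x \<noteq> \<zero>\<^bsub>K\<^esub>} \<subseteq> carrier M},
     monoid.mult = (\<lambda>a b x. \<Oplus>\<^bsub>K\<^esub>y \<in> {y. a y \<noteq> \<zero>\<^bsub>K\<^esub>}.
       \<Oplus>\<^bsub>K\<^esub>z \<in> {z. b z \<noteq> \<zero>\<^bsub>K\<^esub> \<and> y \<otimes>\<^bsub>M\<^esub> z = x}. a y \<otimes>\<^bsub>K\<^esub> b z),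
     one = (\<lambda>x. if x = \<one>\<^bsub>M\<^esub> then \<one>\<^bsub>K\<^esub> else \<zero>\<^bsub>K\<^esub>),
     ring.zero = (\<lambda>x. \<zero>\<^bsub>K\<^esub>),
     add = (\<lambda>a b x. a x \<oplus>\<^bsub>K\<^esub> b x)\<rparr>"

text \<open>The scalar multiplication on \<open>Ind(W)\<close> is the linear extension of the action of \<open>M\<close> in which
  units act as on \<open>W\<close> and nonunits act as zero.\<close>

definition Ind ::
  "('k, 's) ring_scheme \<Rightarrow> ('m, 't) monoid_scheme \<Rightarrow> ('m \<Rightarrow> 'k, 'w) module \<Rightarrow> ('m \<Rightarrow> 'k, 'w) module"
  where "Ind K M W = W\<lparr>smult := \<lambda>a w. (\<lambda>x. if x \<in> Units M then a x else \<zero>\<^bsub>K\<^esub>) \<odot>\<^bsub>W\<^esub> w\<rparr>"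

text \<open>For finite \<open>M\<close>, every projective indecomposable module over the algebra of the group of units
  is isomorphic to a left ideal of that algebra, so asking for \<open>P\<close> on the type of elements of
  the algebra is no restriction.\<close>

definition group_injective :: "('k, 's) ring_scheme \<Rightarrow> ('m, 't) monoid_scheme \<Rightarrow> bool"
  where "group_injective K M \<longleftrightarrow>
    (\<exists>P :: ('m \<Rightarrow> 'k, 'm \<Rightarrow> 'k) module.
      projective_module TYPE(('m \<Rightarrow> 'k) \<Rightarrow> ('m \<Rightarrow> 'k)) TYPE('m \<Rightarrow> 'k)
        (monoid_algebra K (units_of M)) P \<and>
      indecomposable_module (monoid_algebra K (units_of M)) P \<and>
      injective_module TYPE('m \<Rightarrow> 'k) TYPE('m \<Rightarrow> 'k) (monoid_algebra K M) (Ind K M P))"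


section \<open>The Catalan monoid\<close>

definition catalan_monoid :: "nat \<Rightarrow> (nat \<Rightarrow> nat) monoid"
  where "catalan_monoid m =
    \<lparr>carrier = {f \<in> {1..m} \<rightarrow>\<^sub>E {1..m}. mono_on {1..m} f \<and> (\<forall>x\<in>{1..m}. x \<le> f x)},
     monoid.mult = (\<lambda>f g. compose {1..m} f g),
     one = (\<lambda>x\<in>{1..m}. x)\<rparr>"


section \<open>The choice of types of test modules is immaterial\<close>

lemma left_module_hom_closed:
  "\<lbrakk>h \<in> left_module_hom R A B; x \<in> carrier A\<rbrakk> \<Longrightarrow> h x \<in> carrier B"
  by (auto simp: left_module_hom_def)

lemma left_module_hom_add:
  "\<lbrakk>h \<in> left_module_hom R A B; x \<in> carrier A; y \<in> carrier A\<rbrakk> \<Longrightarrow> h (x \<oplus>\<^bsub>A\<^esub> y) = h x \<oplus>\<^bsub>B\<^esub> h y"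
  by (auto simp: left_module_hom_def)

lemma left_module_hom_smult:
  "\<lbrakk>h \<in> left_module_hom R A B; r \<in> carrier R; x \<in> carrier A\<rbrakk> \<Longrightarrow> h (r \<odot>\<^bsub>A\<^esub> x) = r \<odot>\<^bsub>B\<^esub> h x"
  by (auto simp: left_module_hom_def)

lemma left_module_hom_zero:
  assumes "left_module R A" "left_module R B" "h \<in> left_module_hom R A B"
  shows "h \<zero>\<^bsub>A\<^esub> = \<zero>\<^bsub>B\<^esub>"
proof -
  interpret A: left_module R A by fact
  interpret B: left_module R B by fact
  have "h \<zero>\<^bsub>A\<^esub> = h (\<zero>\<^bsub>R\<^esub> \<odot>\<^bsub>A\<^esub> \<zero>\<^bsub>A\<^esub>)" by simp
  also have "\<dots> = \<zero>\<^bsub>R\<^esub> \<odot>\<^bsub>B\<^esub> h \<zero>\<^bsub>A\<^esub>"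
    using left_module_hom_smult[OF assms(3)] A.R.zero_closed A.M.zero_closed by blast
  also have "\<dots> = \<zero>\<^bsub>B\<^esub>"
    using left_module_hom_closed[OF assms(3)] A.M.zero_closed by (intro B.smult_l_null) blast
  finally show ?thesis .
qed

definition ideal_as_module :: "('r, 's) ring_scheme \<Rightarrow> 'r set \<Rightarrow> ('r, 'r) module"
  where "ideal_as_module R I =
    \<lparr>carrier = I, monoid.mult = monoid.mult R, one = \<one>\<^bsub>R\<^esub>,
     ring.zero = \<zero>\<^bsub>R\<^esub>, add = add R, smult = monoid.mult R\<rparr>"

lemma ideal_as_module_left_module:
  assumes "ring R" and sub: "I \<subseteq> carrier R" and "\<zero>\<^bsub>R\<^esub> \<in> I"
    and add: "\<And>x y. \<lbrakk>x \<in> I; y \<in> I\<rbrakk> \<Longrightarrow> x \<oplus>\<^bsub>R\<^esub> y \<in> I"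
    and mul: "\<And>r x. \<lbrakk>r \<in> carrier R; x \<in> I\<rbrakk> \<Longrightarrow> r \<otimes>\<^bsub>R\<^esub> x \<in> I"
  shows "left_module R (ideal_as_module R I)"
proof -
  interpret ring R by fact
  have neg: "\<ominus>\<^bsub>R\<^esub> x \<in> I" if "x \<in> I" for x
    using mul[of "\<ominus>\<^bsub>R\<^esub> \<one>\<^bsub>R\<^esub>" x] that sub by (auto simp: l_minus)
  have "abelian_group (ideal_as_module R I)"
  proof (rule abelian_groupI)
    fix x assume "x \<in> carrier (ideal_as_module R I)"
    then have x: "x \<in> I"
      by (simp add: ideal_as_module_def)
    then have "\<ominus>\<^bsub>R\<^esub> x \<oplus>\<^bsub>ideal_as_module R I\<^esub> x = \<zero>\<^bsub>ideal_as_module R I\<^esub>"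
      using sub by (auto simp: ideal_as_module_def l_neg)
    then show "\<exists>y\<in>carrier (ideal_as_module R I). y \<oplus>\<^bsub>ideal_as_module R I\<^esub> x = \<zero>\<^bsub>ideal_as_module R I\<^esub>"
      using neg[OF x] by (auto simp: ideal_as_module_def)
  qed (use assms in \<open>auto simp: ideal_as_module_def a_ac subset_iff\<close>)
  then show ?thesis
    using assms
    by (intro left_module.intro left_module_axioms.intro)
       (auto simp: ideal_as_module_def subset_iff l_distr r_distr m_assoc)
qed

text \<open>Graphs of partial homomorphisms, for the maximality argument in Baer's criterion.\<close>

definition hom_graph ::
  "('r, 's) ring_scheme \<Rightarrow> ('r, 'b) module \<Rightarrow> ('r, 'w) module \<Rightarrow> ('b \<times> 'w) set \<Rightarrow> bool"
  where "hom_graph R B W G \<longleftrightarrow>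
    G \<subseteq> carrier B \<times> carrier W \<and> (\<zero>\<^bsub>B\<^esub>, \<zero>\<^bsub>W\<^esub>) \<in> G \<and>
    (\<forall>x y x' y'. (x, y) \<in> G \<and> (x', y') \<in> G \<longrightarrow> (x \<oplus>\<^bsub>B\<^esub> x', y \<oplus>\<^bsub>W\<^esub> y') \<in> G) \<and>
    (\<forall>r\<in>carrier R. \<forall>x y. (x, y) \<in> G \<longrightarrow> (r \<odot>\<^bsub>B\<^esub> x, r \<odot>\<^bsub>W\<^esub> y) \<in> G) \<and>
    (\<forall>y. (\<zero>\<^bsub>B\<^esub>, y) \<in> G \<longrightarrow> y = \<zero>\<^bsub>W\<^esub>)"

lemma hom_graph_unique:
  assumes "left_module R B" "left_module R W" "hom_graph R B W G" "(x, y) \<in> G" "(x, y') \<in> G"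
  shows "y = y'"
proof -
  interpret B: left_module R B by fact
  interpret W: left_module R W by fact
  have c: "x \<in> carrier B" "y \<in> carrier W" "y' \<in> carrier W"
    using assms(3-5) by (auto simp: hom_graph_def)
  have "((\<ominus>\<^bsub>R\<^esub> \<one>\<^bsub>R\<^esub>) \<odot>\<^bsub>B\<^esub> x, (\<ominus>\<^bsub>R\<^esub> \<one>\<^bsub>R\<^esub>) \<odot>\<^bsub>W\<^esub> y') \<in> G"
    using assms(3,5) B.R.add.inv_closed[OF B.R.one_closed] unfolding hom_graph_def by blast
  then have "(\<ominus>\<^bsub>B\<^esub> x, \<ominus>\<^bsub>W\<^esub> y') \<in> G"
    using c by (simp add: B.smult_minus_one W.smult_minus_one)
  then have "(x \<oplus>\<^bsub>B\<^esub> \<ominus>\<^bsub>B\<^esub> x, y \<oplus>\<^bsub>W\<^esub> \<ominus>\<^bsub>W\<^esub> y') \<in> G"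
    using assms(3,4) unfolding hom_graph_def by blast
  then have "(\<zero>\<^bsub>B\<^esub>, y \<oplus>\<^bsub>W\<^esub> \<ominus>\<^bsub>W\<^esub> y') \<in> G"
    using c by (simp add: B.M.r_neg)
  then have "y \<oplus>\<^bsub>W\<^esub> \<ominus>\<^bsub>W\<^esub> y' = \<zero>\<^bsub>W\<^esub>"
    using assms(3) unfolding hom_graph_def by blast
  then show ?thesis
    using c by (metis W.M.add.inv_closed W.M.minus_equality W.M.minus_minus)
qed

lemma hom_graph_Union:
  assumes chain: "subset.chain {G. hom_graph R B W G} \<C>" and "\<C> \<noteq> {}"
  shows "hom_graph R B W (\<Union>\<C>)"
proof -
  have hg: "hom_graph R B W G" if "G \<in> \<C>" for G
    using chain that by (auto simp: subset_chain_def)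
  have add: "(x \<oplus>\<^bsub>B\<^esub> x', y \<oplus>\<^bsub>W\<^esub> y') \<in> \<Union>\<C>" if xy: "(x, y) \<in> \<Union>\<C>" "(x', y') \<in> \<Union>\<C>" for x y x' y'
  proof -
    obtain G G' where G: "G \<in> \<C>" "(x, y) \<in> G" "G' \<in> \<C>" "(x', y') \<in> G'"
      using xy by blast
    then have "G \<subseteq> G' \<or> G' \<subseteq> G"
      using chain by (auto simp: subset_chain_def)
    then obtain H where "H \<in> \<C>" "(x, y) \<in> H" "(x', y') \<in> H"
      using G by blast
    then show ?thesis
      using hg[of H] unfolding hom_graph_def by blast
  qed
  have sub: "\<Union>\<C> \<subseteq> carrier B \<times> carrier W"
    using hg unfolding hom_graph_def by blast
  have zero: "(\<zero>\<^bsub>B\<^esub>, \<zero>\<^bsub>W\<^esub>) \<in> \<Union>\<C>"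
    using hg assms(2) unfolding hom_graph_def by blast
  have smult: "\<forall>r\<in>carrier R. \<forall>x y. (x, y) \<in> \<Union>\<C> \<longrightarrow> (r \<odot>\<^bsub>B\<^esub> x, r \<odot>\<^bsub>W\<^esub> y) \<in> \<Union>\<C>"
    using hg unfolding hom_graph_def by blast
  have sv: "\<forall>y. (\<zero>\<^bsub>B\<^esub>, y) \<in> \<Union>\<C> \<longrightarrow> y = \<zero>\<^bsub>W\<^esub>"
    using hg unfolding hom_graph_def by blast
  show ?thesis
    unfolding hom_graph_def using sub zero add smult sv by blast
qed

lemma hom_graph_extend:
  fixes R :: "('r, 's) ring_scheme"
  assumes B: "left_module R B" and W: "injective_module TYPE('r) TYPE('r) R W"
    and G: "hom_graph R B W G" and b: "b \<in> carrier B"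
  shows "\<exists>G'. hom_graph R B W G' \<and> G \<subseteq> G' \<and> b \<in> fst ` G'"
proof -
  interpret B: left_module R B by fact
  have lW: "left_module R W"
    using W by (simp add: injective_module_def)
  interpret W: left_module R W by fact
  have Gsub: "x \<in> carrier B" "y \<in> carrier W" if "(x, y) \<in> G" for x y
    using G that by (auto simp: hom_graph_def)
  have Gzero: "(\<zero>\<^bsub>B\<^esub>, \<zero>\<^bsub>W\<^esub>) \<in> G"
    using G by (simp add: hom_graph_def)
  have Gadd: "(x \<oplus>\<^bsub>B\<^esub> x', y \<oplus>\<^bsub>W\<^esub> y') \<in> G" if "(x, y) \<in> G" "(x', y') \<in> G" for x y x' y'
    using G that unfolding hom_graph_def by blast
  have Gsm: "(r \<odot>\<^bsub>B\<^esub> x, r \<odot>\<^bsub>W\<^esub> y) \<in> G" if "r \<in> carrier R" "(x, y) \<in> G" for r x y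
    using G that unfolding hom_graph_def by blast
  have Guniq: "y = y'" if "(x, y) \<in> G" "(x, y') \<in> G" for x y y'
    using hom_graph_unique[OF B lW G] that by blast
  define I where "I = {r \<in> carrier R. \<exists>y. (r \<odot>\<^bsub>B\<^esub> b, y) \<in> G}"
  define h where "h r = (THE y. (r \<odot>\<^bsub>B\<^esub> b, y) \<in> G)" for r
  have hI: "h r = y" if "(r \<odot>\<^bsub>B\<^esub> b, y) \<in> G" for r y
    unfolding h_def using that Guniq by blast
  have I0: "\<zero>\<^bsub>R\<^esub> \<in> I"
    using Gzero b by (auto simp: I_def)
  have Iadd: "r \<oplus>\<^bsub>R\<^esub> s \<in> I \<and> h (r \<oplus>\<^bsub>R\<^esub> s) = h r \<oplus>\<^bsub>W\<^esub> h s" if rs: "r \<in> I" "s \<in> I" for r s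
  proof -
    obtain y z where y: "(r \<odot>\<^bsub>B\<^esub> b, y) \<in> G" and z: "(s \<odot>\<^bsub>B\<^esub> b, z) \<in> G"
      and c: "r \<in> carrier R" "s \<in> carrier R"
      using rs by (auto simp: I_def)
    have "((r \<oplus>\<^bsub>R\<^esub> s) \<odot>\<^bsub>B\<^esub> b, y \<oplus>\<^bsub>W\<^esub> z) \<in> G"
      using Gadd[OF y z] b c by (simp add: B.smult_l_distr)
    then show ?thesis
      using c hI[OF y] hI[OF z] hI unfolding I_def by blast
  qed
  have Ismult: "r \<otimes>\<^bsub>R\<^esub> s \<in> I \<and> h (r \<otimes>\<^bsub>R\<^esub> s) = r \<odot>\<^bsub>W\<^esub> h s" if rs: "r \<in> carrier R" "s \<in> I" for r s
  proof -
    obtain z where z: "(s \<odot>\<^bsub>B\<^esub> b, z) \<in> G" and c: "s \<in> carrier R"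
      using rs by (auto simp: I_def)
    have "((r \<otimes>\<^bsub>R\<^esub> s) \<odot>\<^bsub>B\<^esub> b, r \<odot>\<^bsub>W\<^esub> z) \<in> G"
      using Gsm[OF rs(1) z] b c rs by (simp add: B.smult_assoc1)
    then show ?thesis
      using c rs hI[OF z] hI unfolding I_def by blast
  qed
  have Isub: "I \<subseteq> carrier R"
    by (auto simp: I_def)
  have lI: "left_module R (ideal_as_module R I)"
    using Iadd Ismult I0 Isub B.R.ring_axioms by (intro ideal_as_module_left_module) auto
  have lR: "left_module R (ideal_as_module R (carrier R))"
    using B.R.ring_axioms by (intro ideal_as_module_left_module) auto
  have id: "id \<in> left_module_hom R (ideal_as_module R I) (ideal_as_module R (carrier R))"
    using Isub by (auto simp: left_module_hom_def ideal_as_module_def)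
  have "h r \<in> carrier W" if "r \<in> I" for r
    using that hI Gsub unfolding I_def by blast
  then have hh: "h \<in> left_module_hom R (ideal_as_module R I) W"
    using Iadd Ismult by (auto simp: left_module_hom_def ideal_as_module_def)
  obtain g where g: "g \<in> left_module_hom R (ideal_as_module R (carrier R)) W"
    and gh: "\<And>x. x \<in> I \<Longrightarrow> g x = h x"
    using W lI lR id hh unfolding injective_module_def
    by (metis (no_types, lifting) id_apply inj_on_id ideal_as_module_def partial_object.select_convs(1))
  define w where "w = g \<one>\<^bsub>R\<^esub>"
  have w: "w \<in> carrier W"
    using left_module_hom_closed[OF g] by (simp add: w_def ideal_as_module_def)
  have hw: "h r = r \<odot>\<^bsub>W\<^esub> w" if "r \<in> I" for r
    using that gh[of r] left_module_hom_smult[OF g, of r "\<one>\<^bsub>R\<^esub>"] Isub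
    by (auto simp: w_def ideal_as_module_def subset_iff)
  define G' where "G' = {(x \<oplus>\<^bsub>B\<^esub> r \<odot>\<^bsub>B\<^esub> b, y \<oplus>\<^bsub>W\<^esub> r \<odot>\<^bsub>W\<^esub> w) | x y r. (x, y) \<in> G \<and> r \<in> carrier R}"
  have GG': "G \<subseteq> G'"
  proof
    fix p assume p: "p \<in> G"
    obtain x y where xy: "p = (x, y)" by (cases p)
    have "(x \<oplus>\<^bsub>B\<^esub> \<zero>\<^bsub>R\<^esub> \<odot>\<^bsub>B\<^esub> b, y \<oplus>\<^bsub>W\<^esub> \<zero>\<^bsub>R\<^esub> \<odot>\<^bsub>W\<^esub> w) \<in> G'"
      unfolding G'_def using p xy B.R.zero_closed by blast
    then show "p \<in> G'"
      using p xy Gsub b w by simp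
  qed
  have "(\<zero>\<^bsub>B\<^esub> \<oplus>\<^bsub>B\<^esub> \<one>\<^bsub>R\<^esub> \<odot>\<^bsub>B\<^esub> b, \<zero>\<^bsub>W\<^esub> \<oplus>\<^bsub>W\<^esub> \<one>\<^bsub>R\<^esub> \<odot>\<^bsub>W\<^esub> w) \<in> G'"
    unfolding G'_def using Gzero B.R.one_closed by blast
  then have "(b, \<zero>\<^bsub>W\<^esub> \<oplus>\<^bsub>W\<^esub> \<one>\<^bsub>R\<^esub> \<odot>\<^bsub>W\<^esub> w) \<in> G'"
    using b by simp
  then have bG': "b \<in> fst ` G'"
    by force
  have "hom_graph R B W G'"
    unfolding hom_graph_def
  proof (intro conjI allI impI ballI)
    show "G' \<subseteq> carrier B \<times> carrier W"
      using Gsub b w by (auto simp: G'_def)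
    show "(\<zero>\<^bsub>B\<^esub>, \<zero>\<^bsub>W\<^esub>) \<in> G'"
      using GG' Gzero by blast
  next
    fix x y x' y' assume "(x, y) \<in> G' \<and> (x', y') \<in> G'"
    then obtain u v r u' v' r' where
      1: "(u, v) \<in> G" "r \<in> carrier R" "x = u \<oplus>\<^bsub>B\<^esub> r \<odot>\<^bsub>B\<^esub> b" "y = v \<oplus>\<^bsub>W\<^esub> r \<odot>\<^bsub>W\<^esub> w" and
      2: "(u', v') \<in> G" "r' \<in> carrier R" "x' = u' \<oplus>\<^bsub>B\<^esub> r' \<odot>\<^bsub>B\<^esub> b" "y' = v' \<oplus>\<^bsub>W\<^esub> r' \<odot>\<^bsub>W\<^esub> w"
      unfolding G'_def by blast
    have "x \<oplus>\<^bsub>B\<^esub> x' = (u \<oplus>\<^bsub>B\<^esub> u') \<oplus>\<^bsub>B\<^esub> (r \<oplus>\<^bsub>R\<^esub> r') \<odot>\<^bsub>B\<^esub> b"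
      using 1 2 Gsub b by (simp add: B.smult_l_distr B.M.a_ac)
    moreover have "y \<oplus>\<^bsub>W\<^esub> y' = (v \<oplus>\<^bsub>W\<^esub> v') \<oplus>\<^bsub>W\<^esub> (r \<oplus>\<^bsub>R\<^esub> r') \<odot>\<^bsub>W\<^esub> w"
      using 1 2 Gsub w by (simp add: W.smult_l_distr W.M.a_ac)
    ultimately show "(x \<oplus>\<^bsub>B\<^esub> x', y \<oplus>\<^bsub>W\<^esub> y') \<in> G'"
      unfolding G'_def using Gadd[OF 1(1) 2(1)] 1(2) 2(2) B.R.a_closed by blast
  next
    fix s x y assume s: "s \<in> carrier R" and "(x, y) \<in> G'"
    then obtain u v r where
      1: "(u, v) \<in> G" "r \<in> carrier R" "x = u \<oplus>\<^bsub>B\<^esub> r \<odot>\<^bsub>B\<^esub> b" "y = v \<oplus>\<^bsub>W\<^esub> r \<odot>\<^bsub>W\<^esub> w"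
      unfolding G'_def by blast
    have "s \<odot>\<^bsub>B\<^esub> x = s \<odot>\<^bsub>B\<^esub> u \<oplus>\<^bsub>B\<^esub> (s \<otimes>\<^bsub>R\<^esub> r) \<odot>\<^bsub>B\<^esub> b"
      using 1 s Gsub b by (simp add: B.smult_r_distr B.smult_assoc1)
    moreover have "s \<odot>\<^bsub>W\<^esub> y = s \<odot>\<^bsub>W\<^esub> v \<oplus>\<^bsub>W\<^esub> (s \<otimes>\<^bsub>R\<^esub> r) \<odot>\<^bsub>W\<^esub> w"
      using 1 s Gsub w by (simp add: W.smult_r_distr W.smult_assoc1)
    ultimately show "(s \<odot>\<^bsub>B\<^esub> x, s \<odot>\<^bsub>W\<^esub> y) \<in> G'"
      unfolding G'_def using Gsm[OF s 1(1)] s 1(2) B.R.m_closed by blast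
  next
    fix y assume "(\<zero>\<^bsub>B\<^esub>, y) \<in> G'"
    then obtain u v r where
      1: "(u, v) \<in> G" "r \<in> carrier R" "\<zero>\<^bsub>B\<^esub> = u \<oplus>\<^bsub>B\<^esub> r \<odot>\<^bsub>B\<^esub> b" "y = v \<oplus>\<^bsub>W\<^esub> r \<odot>\<^bsub>W\<^esub> w"
      unfolding G'_def by blast
    have cu: "u \<in> carrier B" "v \<in> carrier W"
      using Gsub 1(1) by auto
    have "((\<ominus>\<^bsub>R\<^esub> \<one>\<^bsub>R\<^esub>) \<odot>\<^bsub>B\<^esub> u, (\<ominus>\<^bsub>R\<^esub> \<one>\<^bsub>R\<^esub>) \<odot>\<^bsub>W\<^esub> v) \<in> G"
      using Gsm 1(1) by simp
    then have "(\<ominus>\<^bsub>B\<^esub> u, \<ominus>\<^bsub>W\<^esub> v) \<in> G"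
      using cu by (simp add: B.smult_minus_one W.smult_minus_one)
    moreover have "r \<odot>\<^bsub>B\<^esub> b = \<ominus>\<^bsub>B\<^esub> u"
      using 1 cu b by (metis B.M.a_comm B.M.minus_equality B.smult_closed)
    ultimately have rG: "(r \<odot>\<^bsub>B\<^esub> b, \<ominus>\<^bsub>W\<^esub> v) \<in> G"
      by simp
    then have "r \<in> I"
      using 1(2) by (auto simp: I_def)
    then have "r \<odot>\<^bsub>W\<^esub> w = \<ominus>\<^bsub>W\<^esub> v"
      using hw hI[OF rG] by simp
    then show "y = \<zero>\<^bsub>W\<^esub>"
      using 1(4) cu by (simp add: W.M.r_neg)
  qed
  then show ?thesis
    using GG' bG' by blast
qed

lemma injective_module_any_type:
  fixes R :: "('r, 's) ring_scheme"
  assumes W: "injective_module TYPE('r) TYPE('r) R W"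
  shows "injective_module TYPE('a) TYPE('b) R W"
proof -
  have lW: "left_module R W"
    using W by (simp add: injective_module_def)
  interpret W: left_module R W by fact
  have "\<exists>g \<in> left_module_hom R B W. \<forall>x\<in>carrier A. g (i x) = f x"
    if lA: "left_module R A" and lB: "left_module R B" and i: "i \<in> left_module_hom R A B"
      and inj: "inj_on i (carrier A)" and f: "f \<in> left_module_hom R A W"
    for A :: "('r, 'a) module" and B :: "('r, 'b) module" and i f
  proof -
    interpret A: left_module R A by fact
    interpret B: left_module R B by fact
    define G0 where "G0 = (\<lambda>x. (i x, f x)) ` carrier A"
    have G0: "hom_graph R B W G0"
      unfolding hom_graph_def
    proof (intro conjI allI impI ballI)
      show "G0 \<subseteq> carrier B \<times> carrier W"
        using left_module_hom_closed[OF i] left_module_hom_closed[OF f] by (auto simp: G0_def)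
      show "(\<zero>\<^bsub>B\<^esub>, \<zero>\<^bsub>W\<^esub>) \<in> G0"
        unfolding G0_def
        by (rule image_eqI[of _ _ "\<zero>\<^bsub>A\<^esub>"])
           (simp_all add: left_module_hom_zero[OF lA lB i] left_module_hom_zero[OF lA lW f])
    next
      fix x y x' y' assume "(x, y) \<in> G0 \<and> (x', y') \<in> G0"
      then obtain a a' where "a \<in> carrier A" "a' \<in> carrier A" "x = i a" "y = f a" "x' = i a'" "y' = f a'"
        by (auto simp: G0_def)
      then show "(x \<oplus>\<^bsub>B\<^esub> x', y \<oplus>\<^bsub>W\<^esub> y') \<in> G0"
        unfolding G0_def
        by (intro image_eqI[of _ _ "a \<oplus>\<^bsub>A\<^esub> a'"])
           (simp_all add: left_module_hom_add[OF i] left_module_hom_add[OF f])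
    next
      fix r x y assume r: "r \<in> carrier R" and "(x, y) \<in> G0"
      then obtain a where "a \<in> carrier A" "x = i a" "y = f a"
        by (auto simp: G0_def)
      with r show "(r \<odot>\<^bsub>B\<^esub> x, r \<odot>\<^bsub>W\<^esub> y) \<in> G0"
        unfolding G0_def
        by (intro image_eqI[of _ _ "r \<odot>\<^bsub>A\<^esub> a"])
           (simp_all add: left_module_hom_smult[OF i] left_module_hom_smult[OF f])
    next
      fix y assume "(\<zero>\<^bsub>B\<^esub>, y) \<in> G0"
      then obtain a where a: "a \<in> carrier A" "\<zero>\<^bsub>B\<^esub> = i a" "y = f a"
        by (auto simp: G0_def)
      then have "a = \<zero>\<^bsub>A\<^esub>"
        using left_module_hom_zero[OF lA lB i] inj by (metis A.M.zero_closed inj_onD)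
      then show "y = \<zero>\<^bsub>W\<^esub>"
        using a left_module_hom_zero[OF lA lW f] by simp
    qed
    define \<G> where "\<G> = {G. hom_graph R B W G \<and> G0 \<subseteq> G}"
    have "\<exists>G\<in>\<G>. \<forall>U\<in>\<G>. G \<subseteq> U \<longrightarrow> U = G"
    proof (rule subset_Zorn_nonempty)
      show "\<G> \<noteq> {}"
        using G0 by (auto simp: \<G>_def)
      fix \<C> assume ne: "\<C> \<noteq> {}" and ch: "subset.chain \<G> \<C>"
      have "subset.chain {G. hom_graph R B W G} \<C>"
        using ch by (auto simp: subset_chain_def \<G>_def)
      then have "hom_graph R B W (\<Union>\<C>)"
        using ne by (rule hom_graph_Union)
      moreover obtain G where "G \<in> \<C>"
        using ne by blast
      then have "G0 \<subseteq> \<Union>\<C>"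
        using ch unfolding subset_chain_def \<G>_def by blast
      ultimately show "\<Union>\<C> \<in> \<G>"
        by (simp add: \<G>_def)
    qed
    then obtain G where "G \<in> \<G>" and max_G: "\<forall>U\<in>\<G>. G \<subseteq> U \<longrightarrow> U = G"
      by (rule bexE)
    then have G: "hom_graph R B W G" "G0 \<subseteq> G"
      by (simp_all add: \<G>_def)
    have max: "U = G" if "hom_graph R B W U" "G \<subseteq> U" for U
    proof -
      have "U \<in> \<G>"
        using that G(2) by (auto simp: \<G>_def)
      then show ?thesis
        using max_G that(2) by simp
    qed
    have total: "\<exists>y. (x, y) \<in> G" if x: "x \<in> carrier B" for x
    proof -
      obtain G' where "hom_graph R B W G'" "G \<subseteq> G'" "x \<in> fst ` G'"
        using hom_graph_extend[OF lB W G(1) x] by blast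
      then show ?thesis
        using max[of G'] by (metis imageE prod.collapse)
    qed
    define g where "g x = (THE y. (x, y) \<in> G)" for x
    have gI: "g x = y" if "(x, y) \<in> G" for x y
      unfolding g_def using that hom_graph_unique[OF lB lW G(1)] by blast
    have gG: "(x, g x) \<in> G" if "x \<in> carrier B" for x
      using total[OF that] gI by blast
    have "g \<in> left_module_hom R B W"
      unfolding left_module_hom_def
    proof (intro CollectI conjI ballI Pi_I)
      show "g x \<in> carrier W" if "x \<in> carrier B" for x
        using gG[OF that] G(1) by (auto simp: hom_graph_def)
      show "g (x \<oplus>\<^bsub>B\<^esub> y) = g x \<oplus>\<^bsub>W\<^esub> g y" if "x \<in> carrier B" "y \<in> carrier B" for x y
        using gG[OF that(1)] gG[OF that(2)] G(1) unfolding hom_graph_def by (intro gI) blast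
      show "g (r \<odot>\<^bsub>B\<^esub> x) = r \<odot>\<^bsub>W\<^esub> g x" if "r \<in> carrier R" "x \<in> carrier B" for r x
        using gG[OF that(2)] that(1) G(1) unfolding hom_graph_def by (intro gI) blast
    qed
    moreover have "g (i x) = f x" if "x \<in> carrier A" for x
      using G(2) that by (intro gI) (auto simp: G0_def)
    ultimately show ?thesis
      by (intro bexI[of _ g]) auto
  qed
  then show ?thesis
    using lW unfolding injective_module_def by blast
qed

text \<open>The free module on the elements of \<open>P\<close>, for projectivity.\<close>

definition free_module :: "('r, 's) ring_scheme \<Rightarrow> 'p set \<Rightarrow> ('r, 'p \<Rightarrow> 'r) module"
  where "free_module R U =
    \<lparr>carrier = {a \<in> UNIV \<rightarrow> carrier R. finite {x. a x \<noteq> \<zero>\<^bsub>R\<^esub>} \<and> {x. a x \<noteq> \<zero>\<^bsub>R\<^esub>} \<subseteq> U},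
     monoid.mult = (\<lambda>a b. a), one = (\<lambda>x. \<zero>\<^bsub>R\<^esub>),
     ring.zero = (\<lambda>x. \<zero>\<^bsub>R\<^esub>),
     add = (\<lambda>a b x. a x \<oplus>\<^bsub>R\<^esub> b x),
     smult = (\<lambda>r a x. r \<otimes>\<^bsub>R\<^esub> a x)\<rparr>"

definition free_eval :: "('r, 's) ring_scheme \<Rightarrow> ('r, 'n) module \<Rightarrow> ('p \<Rightarrow> 'n) \<Rightarrow> ('p \<Rightarrow> 'r) \<Rightarrow> 'n"
  where "free_eval R N t a = (\<Oplus>\<^bsub>N\<^esub>x \<in> {x. a x \<noteq> \<zero>\<^bsub>R\<^esub>}. a x \<odot>\<^bsub>N\<^esub> t x)"

lemma free_module_left_module:
  assumes "ring R"
  shows "left_module R (free_module R U)"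
proof -
  interpret ring R by fact
  have fin: "finite {x. h x \<noteq> \<zero>\<^bsub>R\<^esub>} \<and> {x. h x \<noteq> \<zero>\<^bsub>R\<^esub>} \<subseteq> U"
    if "finite {x. f x \<noteq> \<zero>\<^bsub>R\<^esub>} \<and> {x. f x \<noteq> \<zero>\<^bsub>R\<^esub>} \<subseteq> U"
      "finite {x. g x \<noteq> \<zero>\<^bsub>R\<^esub>} \<and> {x. g x \<noteq> \<zero>\<^bsub>R\<^esub>} \<subseteq> U"
      "\<And>x. \<lbrakk>f x = \<zero>\<^bsub>R\<^esub>; g x = \<zero>\<^bsub>R\<^esub>\<rbrakk> \<Longrightarrow> h x = \<zero>\<^bsub>R\<^esub>" for f g h
  proof -
    have "{x. h x \<noteq> \<zero>\<^bsub>R\<^esub>} \<subseteq> {x. f x \<noteq> \<zero>\<^bsub>R\<^esub>} \<union> {x. g x \<noteq> \<zero>\<^bsub>R\<^esub>}"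
      using that(3) by auto
    then show ?thesis
      using that(1,2) by (meson finite_Un finite_subset le_sup_iff subset_trans)
  qed
  have c: "f x \<in> carrier R" if "f \<in> carrier (free_module R U)" for f x
    using that by (auto simp: free_module_def)
  have add: "(\<lambda>x. f x \<oplus>\<^bsub>R\<^esub> g x) \<in> carrier (free_module R U)"
    if "f \<in> carrier (free_module R U)" "g \<in> carrier (free_module R U)" for f g
    using that fin[of f g "\<lambda>x. f x \<oplus>\<^bsub>R\<^esub> g x"] by (auto simp: free_module_def)
  have sm: "(\<lambda>x. r \<otimes>\<^bsub>R\<^esub> f x) \<in> carrier (free_module R U)"
    if "r \<in> carrier R" "f \<in> carrier (free_module R U)" for r f
    using that fin[of f f "\<lambda>x. r \<otimes>\<^bsub>R\<^esub> f x"] by (auto simp: free_module_def)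
  have "abelian_group (free_module R U)"
  proof (rule abelian_groupI)
    fix f assume f: "f \<in> carrier (free_module R U)"
    have "(\<lambda>x. \<ominus>\<^bsub>R\<^esub> \<one>\<^bsub>R\<^esub> \<otimes>\<^bsub>R\<^esub> f x) \<oplus>\<^bsub>free_module R U\<^esub> f = \<zero>\<^bsub>free_module R U\<^esub>"
      using c[OF f] by (auto simp: free_module_def l_minus l_neg)
    then show "\<exists>g\<in>carrier (free_module R U). g \<oplus>\<^bsub>free_module R U\<^esub> f = \<zero>\<^bsub>free_module R U\<^esub>"
      using sm[OF _ f, of "\<ominus>\<^bsub>R\<^esub> \<one>\<^bsub>R\<^esub>"] by blast
  next
    fix f g assume "f \<in> carrier (free_module R U)" "g \<in> carrier (free_module R U)"
    then show "f \<oplus>\<^bsub>free_module R U\<^esub> g \<in> carrier (free_module R U)"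
      using add by (simp add: free_module_def)
  next
    show "\<zero>\<^bsub>free_module R U\<^esub> \<in> carrier (free_module R U)"
      by (simp add: free_module_def)
  next
    fix f g h
    assume f: "f \<in> carrier (free_module R U)" and g: "g \<in> carrier (free_module R U)"
    show "f \<oplus>\<^bsub>free_module R U\<^esub> g = g \<oplus>\<^bsub>free_module R U\<^esub> f"
      using a_comm[OF c[OF f] c[OF g]] by (simp add: free_module_def)
    assume h: "h \<in> carrier (free_module R U)"
    show "f \<oplus>\<^bsub>free_module R U\<^esub> g \<oplus>\<^bsub>free_module R U\<^esub> h =
        f \<oplus>\<^bsub>free_module R U\<^esub> (g \<oplus>\<^bsub>free_module R U\<^esub> h)"
      using a_assoc[OF c[OF f] c[OF g] c[OF h]] by (simp add: free_module_def)
  next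
    fix f assume f: "f \<in> carrier (free_module R U)"
    show "\<zero>\<^bsub>free_module R U\<^esub> \<oplus>\<^bsub>free_module R U\<^esub> f = f"
      using l_zero[OF c[OF f]] by (simp add: free_module_def)
  qed
  moreover have "r \<odot>\<^bsub>free_module R U\<^esub> f \<in> carrier (free_module R U)"
    if "r \<in> carrier R" "f \<in> carrier (free_module R U)" for r f
    using sm[OF that] by (simp add: free_module_def)
  moreover have "(r \<oplus>\<^bsub>R\<^esub> r') \<odot>\<^bsub>free_module R U\<^esub> f =
      r \<odot>\<^bsub>free_module R U\<^esub> f \<oplus>\<^bsub>free_module R U\<^esub> r' \<odot>\<^bsub>free_module R U\<^esub> f"
    if "r \<in> carrier R" "r' \<in> carrier R" "f \<in> carrier (free_module R U)" for r r' f
    using l_distr[OF that(1,2) c[OF that(3)]] by (simp add: free_module_def)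
  moreover have "r \<odot>\<^bsub>free_module R U\<^esub> (f \<oplus>\<^bsub>free_module R U\<^esub> g) =
      r \<odot>\<^bsub>free_module R U\<^esub> f \<oplus>\<^bsub>free_module R U\<^esub> r \<odot>\<^bsub>free_module R U\<^esub> g"
    if "r \<in> carrier R" "f \<in> carrier (free_module R U)" "g \<in> carrier (free_module R U)" for r f g
    using r_distr[OF c[OF that(2)] c[OF that(3)] that(1)] by (simp add: free_module_def)
  moreover have "(r \<otimes>\<^bsub>R\<^esub> r') \<odot>\<^bsub>free_module R U\<^esub> f =
      r \<odot>\<^bsub>free_module R U\<^esub> (r' \<odot>\<^bsub>free_module R U\<^esub> f)"
    if "r \<in> carrier R" "r' \<in> carrier R" "f \<in> carrier (free_module R U)" for r r' f
    using m_assoc[OF that(1,2) c[OF that(3)]] by (simp add: free_module_def)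
  moreover have "\<one>\<^bsub>R\<^esub> \<odot>\<^bsub>free_module R U\<^esub> f = f" if "f \<in> carrier (free_module R U)" for f
    using l_one[OF c[OF that]] by (simp add: free_module_def)
  ultimately show ?thesis
    using assms by (intro left_module.intro left_module_axioms.intro)
qed

lemma free_eval_superset:
  assumes "left_module R N" "a \<in> carrier (free_module R U)" "t \<in> U \<rightarrow> carrier N"
    and "finite S" "{x. a x \<noteq> \<zero>\<^bsub>R\<^esub>} \<subseteq> S" "S \<subseteq> U"
  shows "free_eval R N t a = (\<Oplus>\<^bsub>N\<^esub>x\<in>S. a x \<odot>\<^bsub>N\<^esub> t x)"
proof -
  interpret N: left_module R N by fact
  have c: "a x \<in> carrier R" for x
    using assms(2) by (auto simp: free_module_def)
  have "t x \<in> carrier N" if "x \<in> S" for x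
    using that assms(3,6) by auto
  then show ?thesis
    unfolding free_eval_def using assms(4,5) c
    by (intro N.M.add.finprod_mono_neutral_cong_left) auto
qed

lemma free_eval_hom:
  assumes "left_module R N" "t \<in> U \<rightarrow> carrier N"
  shows "free_eval R N t \<in> left_module_hom R (free_module R U) N"
proof -
  interpret N: left_module R N by fact
  interpret F: left_module R "free_module R U"
    by (rule free_module_left_module) (rule N.R.ring_axioms)
  have c: "a x \<in> carrier R" if "a \<in> carrier (free_module R U)" for a x
    using that by (auto simp: free_module_def)
  have tc: "t x \<in> carrier N" if "x \<in> U" for x
    using that assms(2) by auto
  have s: "finite {x. a x \<noteq> \<zero>\<^bsub>R\<^esub>}" "{x. a x \<noteq> \<zero>\<^bsub>R\<^esub>} \<subseteq> U" if "a \<in> carrier (free_module R U)" for a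
    using that by (auto simp: free_module_def)
  show ?thesis
    unfolding left_module_hom_def
  proof (intro CollectI conjI ballI Pi_I)
    fix a assume a: "a \<in> carrier (free_module R U)"
    show "free_eval R N t a \<in> carrier N"
      unfolding free_eval_def using c[OF a] tc s[OF a] by (intro N.M.finsum_closed) auto
    fix b assume b: "b \<in> carrier (free_module R U)"
    define S where "S = {x. a x \<noteq> \<zero>\<^bsub>R\<^esub>} \<union> {x. b x \<noteq> \<zero>\<^bsub>R\<^esub>}"
    have S: "finite S" "S \<subseteq> U" "{x. a x \<noteq> \<zero>\<^bsub>R\<^esub>} \<subseteq> S" "{x. b x \<noteq> \<zero>\<^bsub>R\<^esub>} \<subseteq> S"
      using s[OF a] s[OF b] by (auto simp: S_def)
    have ab: "{x. (a \<oplus>\<^bsub>free_module R U\<^esub> b) x \<noteq> \<zero>\<^bsub>R\<^esub>} \<subseteq> S"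
      by (auto simp: S_def free_module_def)
    have "free_eval R N t (a \<oplus>\<^bsub>free_module R U\<^esub> b) =
        (\<Oplus>\<^bsub>N\<^esub>x\<in>S. (a \<oplus>\<^bsub>free_module R U\<^esub> b) x \<odot>\<^bsub>N\<^esub> t x)"
      using a b by (intro free_eval_superset[OF assms(1) _ assms(2) S(1) ab S(2)]) auto
    also have "\<dots> = (\<Oplus>\<^bsub>N\<^esub>x\<in>S. a x \<odot>\<^bsub>N\<^esub> t x \<oplus>\<^bsub>N\<^esub> b x \<odot>\<^bsub>N\<^esub> t x)"
      using c[OF a] c[OF b] tc S(2)
      by (intro N.M.finsum_cong') (auto simp: free_module_def N.smult_l_distr subset_iff)
    also have "\<dots> = (\<Oplus>\<^bsub>N\<^esub>x\<in>S. a x \<odot>\<^bsub>N\<^esub> t x) \<oplus>\<^bsub>N\<^esub> (\<Oplus>\<^bsub>N\<^esub>x\<in>S. b x \<odot>\<^bsub>N\<^esub> t x)"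
      using c[OF a] c[OF b] tc S(2) by (intro N.M.finsum_addf) auto
    also have "\<dots> = free_eval R N t a \<oplus>\<^bsub>N\<^esub> free_eval R N t b"
      using free_eval_superset[OF assms(1) a assms(2) S(1) S(3) S(2)]
        free_eval_superset[OF assms(1) b assms(2) S(1) S(4) S(2)] by simp
    finally show "free_eval R N t (a \<oplus>\<^bsub>free_module R U\<^esub> b) =
      free_eval R N t a \<oplus>\<^bsub>N\<^esub> free_eval R N t b" .
  next
    fix r a assume r: "r \<in> carrier R" and a: "a \<in> carrier (free_module R U)"
    define S where "S = {x. a x \<noteq> \<zero>\<^bsub>R\<^esub>}"
    have S: "finite S" "S \<subseteq> U"
      using s[OF a] by (auto simp: S_def)
    have ra: "{x. (r \<odot>\<^bsub>free_module R U\<^esub> a) x \<noteq> \<zero>\<^bsub>R\<^esub>} \<subseteq> S"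
      using r by (auto simp: S_def free_module_def)
    have "free_eval R N t (r \<odot>\<^bsub>free_module R U\<^esub> a) =
        (\<Oplus>\<^bsub>N\<^esub>x\<in>S. (r \<odot>\<^bsub>free_module R U\<^esub> a) x \<odot>\<^bsub>N\<^esub> t x)"
      using r a by (intro free_eval_superset[OF assms(1) _ assms(2) S(1) ra S(2)]) auto
    also have "\<dots> = (\<Oplus>\<^bsub>N\<^esub>x\<in>S. r \<odot>\<^bsub>N\<^esub> (a x \<odot>\<^bsub>N\<^esub> t x))"
      using r c[OF a] tc S(2)
      by (intro N.M.finsum_cong') (auto simp: free_module_def N.smult_assoc1 subset_iff)
    also have "\<dots> = r \<odot>\<^bsub>N\<^esub> (\<Oplus>\<^bsub>N\<^esub>x\<in>S. a x \<odot>\<^bsub>N\<^esub> t x)"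
      using S
    proof (induction S rule: finite_induct)
      case (insert x F)
      then show ?case
        using r c[OF a] tc by (simp add: N.smult_r_distr Pi_iff subset_iff)
    qed (use r in simp)
    finally show "free_eval R N t (r \<odot>\<^bsub>free_module R U\<^esub> a) = r \<odot>\<^bsub>N\<^esub> free_eval R N t a"
      by (simp add: free_eval_def S_def)
  qed
qed

lemma free_eval_natural:
  assumes N: "left_module R N" and N': "left_module R N'" and q: "q \<in> left_module_hom R N N'"
    and t: "t \<in> U \<rightarrow> carrier N" and a: "a \<in> carrier (free_module R U)"
  shows "q (free_eval R N t a) = free_eval R N' (\<lambda>x. q (t x)) a"
proof -
  interpret N: left_module R N by fact
  interpret N': left_module R N' by fact
  have c: "a x \<in> carrier R" for x
    using a by (auto simp: free_module_def)
  have s: "finite {x. a x \<noteq> \<zero>\<^bsub>R\<^esub>}" "{x. a x \<noteq> \<zero>\<^bsub>R\<^esub>} \<subseteq> U"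
    using a by (auto simp: free_module_def)
  have qc: "q (t x) \<in> carrier N'" if "x \<in> U" for x
    using left_module_hom_closed[OF q] t that by auto
  have "q (\<Oplus>\<^bsub>N\<^esub>x\<in>S. a x \<odot>\<^bsub>N\<^esub> t x) = (\<Oplus>\<^bsub>N'\<^esub>x\<in>S. a x \<odot>\<^bsub>N'\<^esub> q (t x))" if "finite S" "S \<subseteq> U" for S
    using that
  proof (induction S rule: finite_induct)
    case empty
    then show ?case using left_module_hom_zero[OF N N' q] by simp
  next
    case (insert x F)
    have "(\<Oplus>\<^bsub>N\<^esub>x\<in>F. a x \<odot>\<^bsub>N\<^esub> t x) \<in> carrier N"
      using insert.prems c t by (intro N.M.finsum_closed) auto
    moreover have "a x \<odot>\<^bsub>N\<^esub> t x \<in> carrier N" "t x \<in> carrier N"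
      using insert.prems c t by auto
    moreover have "(\<lambda>x. a x \<odot>\<^bsub>N\<^esub> t x) \<in> F \<rightarrow> carrier N" "(\<lambda>x. a x \<odot>\<^bsub>N'\<^esub> q (t x)) \<in> F \<rightarrow> carrier N'"
      "a x \<odot>\<^bsub>N'\<^esub> q (t x) \<in> carrier N'"
      using insert.prems c qc funcset_mem[OF t] by (auto simp: subset_iff)
    ultimately show ?case
      using insert c by (simp add: left_module_hom_add[OF q] left_module_hom_smult[OF q])
  qed
  from this[OF s] show ?thesis
    by (simp add: free_eval_def)
qed

lemma projective_module_any_type:
  fixes R :: "('r, 's) ring_scheme" and P :: "('r, 'p) module"
  assumes P: "projective_module TYPE('p \<Rightarrow> 'r) TYPE('p) R P"
  shows "projective_module TYPE('a) TYPE('b) R P"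
proof -
  have lP: "left_module R P"
    using P by (simp add: projective_module_def)
  interpret P: left_module R P by fact
  define F where "F = free_module R (carrier P)"
  define \<epsilon> where "\<epsilon> = free_eval R P (\<lambda>x. x)"
  have lF: "left_module R F"
    unfolding F_def by (rule free_module_left_module) (rule P.R.ring_axioms)
  have \<epsilon>: "\<epsilon> \<in> left_module_hom R F P"
    unfolding F_def \<epsilon>_def by (rule free_eval_hom[OF lP]) auto
  have "x \<in> \<epsilon> ` carrier F" if x: "x \<in> carrier P" for x
  proof -
    define d where "d y = (if y = x then \<one>\<^bsub>R\<^esub> else \<zero>\<^bsub>R\<^esub>)" for y
    have sub: "{y. d y \<noteq> \<zero>\<^bsub>R\<^esub>} \<subseteq> {x}"
      by (auto simp: d_def)
    then have d: "d \<in> carrier F"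
      using x finite_subset[OF sub] by (auto simp: F_def free_module_def d_def)
    have "\<epsilon> d = (\<Oplus>\<^bsub>P\<^esub>y\<in>{x}. d y \<odot>\<^bsub>P\<^esub> y)"
      unfolding \<epsilon>_def using d sub x
      by (intro free_eval_superset[OF lP, where U = "carrier P"]) (auto simp: F_def)
    also have "\<dots> = x"
      using x by (simp add: d_def)
    finally show ?thesis
      using d by (metis image_eqI)
  qed
  then have surj: "\<epsilon> ` carrier F = carrier P"
    using left_module_hom_closed[OF \<epsilon>] by blast
  have "(\<lambda>x. x) \<in> left_module_hom R P P"
    by (auto simp: left_module_hom_def)
  then obtain s where s: "s \<in> left_module_hom R P F" and \<epsilon>s: "\<And>x. x \<in> carrier P \<Longrightarrow> \<epsilon> (s x) = x"
    using P lF lP \<epsilon> surj unfolding projective_module_def by blast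
  have "\<exists>g \<in> left_module_hom R P A. \<forall>x\<in>carrier P. q (g x) = f x"
    if lA: "left_module R A" and lB: "left_module R B" and q: "q \<in> left_module_hom R A B"
      and qs: "q ` carrier A = carrier B" and f: "f \<in> left_module_hom R P B"
    for A :: "('r, 'a) module" and B :: "('r, 'b) module" and q f
  proof -
    have "\<forall>x\<in>carrier P. \<exists>a. a \<in> carrier A \<and> q a = f x"
      using qs left_module_hom_closed[OF f] by (metis imageE)
    then obtain t where t: "\<And>x. x \<in> carrier P \<Longrightarrow> t x \<in> carrier A \<and> q (t x) = f x"
      by metis
    have tP: "t \<in> carrier P \<rightarrow> carrier A"
      using t by auto
    define h where "h = free_eval R A t"
    have h: "h \<in> left_module_hom R F A"
      unfolding h_def F_def by (rule free_eval_hom[OF lA tP])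
    have "(\<lambda>x. h (s x)) \<in> left_module_hom R P A"
      using h s by (auto simp: left_module_hom_def Pi_iff)
    moreover have "q (h (s x)) = f x" if x: "x \<in> carrier P" for x
    proof -
      have sx: "s x \<in> carrier (free_module R (carrier P))"
        using left_module_hom_closed[OF s x] by (simp add: F_def)
      have "q (h (s x)) = free_eval R B (\<lambda>y. q (t y)) (s x)"
        unfolding h_def by (rule free_eval_natural[OF lA lB q tP sx])
      also have "\<dots> = free_eval R B (\<lambda>y. f y) (s x)"
      proof -
        interpret B: left_module R B by fact
        have "{y. s x y \<noteq> \<zero>\<^bsub>R\<^esub>} \<subseteq> carrier P" "\<And>y. s x y \<in> carrier R"
          using sx by (auto simp: free_module_def)
        then show ?thesis
          unfolding free_eval_def using t left_module_hom_closed[OF f]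
          by (intro B.M.finsum_cong') auto
      qed
      also have "\<dots> = f (\<epsilon> (s x))"
        unfolding \<epsilon>_def by (rule free_eval_natural[OF lP lB f _ sx, symmetric]) auto
      also have "\<dots> = f x"
        using \<epsilon>s[OF x] by simp
      finally show ?thesis .
    qed
    ultimately show ?thesis
      by (intro bexI[of _ "\<lambda>x. h (s x)"]) auto
  qed
  then show ?thesis
    using lP unfolding projective_module_def by blast
qed

end

(*
The units of C_m are trivial, so P = kG is k itself and Ind(P) is the one-dimensional module on which
every nonidentity element acts as 0. Let e be the signed sum, over all f in C_m with
f(x) in {x, x+1} for all x, of (-1)^(number of moved points) f. If g is not the identity, some j < m
is missing from the image of g; toggling the value of f at j between j and j+1 does not change f g
but flips the sign, so e g = 0. Hence e a = a(1) e for every a in kC_m, where a(1) is the coefficient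
of the identity, while e acts as the identity on Ind(P). A partial homomorphism h from a module B to
Ind(P) factors through multiplication by e, as h(x) = h(e x), so it extends to all of B as linear
functionals on e B do.
*)

theory Submission
  imports Defs
begin

text \<open>Why e helps: e a = a(1) e makes the right ideal e kC_m one-dimensional, and e e = e
  because e(1) = 1. So e kC_m is a projective right module, and Ind(P) is its k-linear dual; this is
  the conceptual reason for injectivity. The proof itself uses neither duals nor dimensions: a
  partial homomorphism is enlarged by one element b at a time, and e b decides which values at b are
  admissible. The side of the multiplication matters. In f g the map g is applied first, so f is
  evaluated only on the image of g and its value at an omitted j is never seen. The scalar a(1) is
  represented inside the algebra, by a(1) times the identity, which is zero or a unit. In this form
  the injectivity criterion can be stated over any ring, without vector spaces.\<close>

section \<open>Monoid algebras of finite monoids\<close>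

lemma (in comm_monoid) finprod_swap:
  assumes "finite A" "finite B" "\<And>x y. \<lbrakk>x \<in> A; y \<in> B\<rbrakk> \<Longrightarrow> f x y \<in> carrier G"
  shows "(\<Otimes>x\<in>A. \<Otimes>y\<in>B. f x y) = (\<Otimes>y\<in>B. \<Otimes>x\<in>A. f x y)"
  using assms(1,3)
proof (induction A rule: finite_induct)
  case empty
  then show ?case by (simp add: finprod_one_eqI)
next
  case (insert a A)
  have *: "(\<lambda>x. \<Otimes>y\<in>B. f x y) \<in> A \<rightarrow> carrier G" "(\<Otimes>y\<in>B. f a y) \<in> carrier G"
    using insert.prems by (auto intro!: finprod_closed)
  have "(\<Otimes>y\<in>B. \<Otimes>x\<in>insert a A. f x y) = (\<Otimes>y\<in>B. f a y \<otimes> (\<Otimes>x\<in>A. f x y))"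
    using insert by (intro finprod_cong') (auto intro!: finprod_insert finprod_closed)
  also have "\<dots> = (\<Otimes>y\<in>B. f a y) \<otimes> (\<Otimes>y\<in>B. \<Otimes>x\<in>A. f x y)"
    using insert.prems by (intro finprod_multf) (auto intro!: finprod_closed)
  finally show ?case
    using insert * by simp
qed

lemmas (in abelian_monoid) finsum_swap = add.finprod_swap

section \<open>The convolution algebra of a finite monoid\<close>

locale finite_monoid_algebra = K?: ring K + M?: monoid M
  for K :: "('k, 's) ring_scheme" and M :: "('m, 't) monoid_scheme" +
  assumes finite_carrier: "finite (carrier M)"
begin

abbreviation KM where "KM \<equiv> monoid_algebra K M"

lemma carrier_iff:
  "a \<in> carrier KM \<longleftrightarrow> (\<forall>x. a x \<in> carrier K) \<and> (\<forall>x. x \<notin> carrier M \<longrightarrow> a x = \<zero>\<^bsub>K\<^esub>)"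
  using finite_subset[OF _ finite_carrier, of "{x. a x \<noteq> \<zero>\<^bsub>K\<^esub>}"]
  by (auto simp: monoid_algebra_def)

lemma coeff_closed: "a \<in> carrier KM \<Longrightarrow> a x \<in> carrier K"
  by (simp add: carrier_iff)

text \<open>The supports in the definition of the product depend on \<open>a\<close> and
  \<open>b\<close>. Padding with zeros, which finiteness of \<open>M\<close> permits, makes both
  sums run over \<open>carrier M\<close>, so that they can be swapped and compared termwise.\<close>

lemma mult_eq:
  assumes a: "a \<in> carrier KM" and b: "b \<in> carrier KM"
  shows "(a \<otimes>\<^bsub>KM\<^esub> b) x = (\<Oplus>\<^bsub>K\<^esub>y\<in>carrier M. \<Oplus>\<^bsub>K\<^esub>z\<in>carrier M.
    if y \<otimes>\<^bsub>M\<^esub> z = x then a y \<otimes>\<^bsub>K\<^esub> b z else \<zero>\<^bsub>K\<^esub>)"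
proof -
  note [simp] = coeff_closed[OF a] coeff_closed[OF b]
  have inner: "(\<Oplus>\<^bsub>K\<^esub>z \<in> {z. b z \<noteq> \<zero>\<^bsub>K\<^esub> \<and> y \<otimes>\<^bsub>M\<^esub> z = x}. a y \<otimes>\<^bsub>K\<^esub> b z) =
      (\<Oplus>\<^bsub>K\<^esub>z\<in>carrier M. if y \<otimes>\<^bsub>M\<^esub> z = x then a y \<otimes>\<^bsub>K\<^esub> b z else \<zero>\<^bsub>K\<^esub>)" for y
    using a b finite_carrier
    by (intro K.add.finprod_mono_neutral_cong_left) (auto simp: carrier_iff)
  have "(a \<otimes>\<^bsub>KM\<^esub> b) x = (\<Oplus>\<^bsub>K\<^esub>y \<in> {y. a y \<noteq> \<zero>\<^bsub>K\<^esub>}. \<Oplus>\<^bsub>K\<^esub>z\<in>carrier M.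
      if y \<otimes>\<^bsub>M\<^esub> z = x then a y \<otimes>\<^bsub>K\<^esub> b z else \<zero>\<^bsub>K\<^esub>)"
    by (simp add: monoid_algebra_def inner)
  also have "\<dots> = (\<Oplus>\<^bsub>K\<^esub>y\<in>carrier M. \<Oplus>\<^bsub>K\<^esub>z\<in>carrier M.
      if y \<otimes>\<^bsub>M\<^esub> z = x then a y \<otimes>\<^bsub>K\<^esub> b z else \<zero>\<^bsub>K\<^esub>)"
    using a b finite_carrier
    by (intro K.add.finprod_mono_neutral_cong_left)
       (auto simp: carrier_iff intro!: K.add.finprod_one_eqI K.finsum_closed)
  finally show ?thesis .
qed

lemma mult_closed:
  assumes "a \<in> carrier KM" "b \<in> carrier KM"
  shows "a \<otimes>\<^bsub>KM\<^esub> b \<in> carrier KM"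
  using assms unfolding carrier_iff[of "a \<otimes>\<^bsub>KM\<^esub> b"]
  by (auto simp: mult_eq coeff_closed[OF assms(1)] coeff_closed[OF assms(2)] intro!: K.finsum_closed K.add.finprod_one_eqI)

text \<open>An element of the algebra is tested against a function \<open>g\<close> on the monoid.
  Each coefficient of the product at \<open>u\<close> collects the pairs with
  \<open>y z = u\<close>, so the test turns into a sum over all pairs. Coefficients need not
  commute, so \<open>g\<close> stays on the right.\<close>

lemma pairing_mult:
  assumes a: "a \<in> carrier KM" and b: "b \<in> carrier KM" and g: "\<And>x. g x \<in> carrier K"
  shows "(\<Oplus>\<^bsub>K\<^esub>u\<in>carrier M. (a \<otimes>\<^bsub>KM\<^esub> b) u \<otimes>\<^bsub>K\<^esub> g u) =
    (\<Oplus>\<^bsub>K\<^esub>y\<in>carrier M. \<Oplus>\<^bsub>K\<^esub>z\<in>carrier M. a y \<otimes>\<^bsub>K\<^esub> b z \<otimes>\<^bsub>K\<^esub> g (y \<otimes>\<^bsub>M\<^esub> z))"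
proof -
  note [simp] = coeff_closed[OF a] coeff_closed[OF b] g
  let ?t = "\<lambda>u y z. if u = y \<otimes>\<^bsub>M\<^esub> z then a y \<otimes>\<^bsub>K\<^esub> b z \<otimes>\<^bsub>K\<^esub> g u else \<zero>\<^bsub>K\<^esub>"
  have t: "?t u y z \<in> carrier K" for u y z
    using a b g by auto
  have "(a \<otimes>\<^bsub>KM\<^esub> b) u \<otimes>\<^bsub>K\<^esub> g u =
      (\<Oplus>\<^bsub>K\<^esub>y\<in>carrier M. \<Oplus>\<^bsub>K\<^esub>z\<in>carrier M. ?t u y z)" for u
  proof -
    have "(a \<otimes>\<^bsub>KM\<^esub> b) u \<otimes>\<^bsub>K\<^esub> g u = (\<Oplus>\<^bsub>K\<^esub>y\<in>carrier M. (\<Oplus>\<^bsub>K\<^esub>z\<in>carrier M.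
        if y \<otimes>\<^bsub>M\<^esub> z = u then a y \<otimes>\<^bsub>K\<^esub> b z else \<zero>\<^bsub>K\<^esub>) \<otimes>\<^bsub>K\<^esub> g u)"
      unfolding mult_eq[OF a b] using a b g
      by (intro K.finsum_ldistr finite_carrier) (auto intro!: K.finsum_closed)
    also have "\<dots> = (\<Oplus>\<^bsub>K\<^esub>y\<in>carrier M. \<Oplus>\<^bsub>K\<^esub>z\<in>carrier M.
        (if y \<otimes>\<^bsub>M\<^esub> z = u then a y \<otimes>\<^bsub>K\<^esub> b z else \<zero>\<^bsub>K\<^esub>) \<otimes>\<^bsub>K\<^esub> g u)"
      using a b g
      by (intro K.finsum_cong' refl K.finsum_ldistr finite_carrier) (auto intro!: K.finsum_closed)
    also have "\<dots> = (\<Oplus>\<^bsub>K\<^esub>y\<in>carrier M. \<Oplus>\<^bsub>K\<^esub>z\<in>carrier M. ?t u y z)"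
      using a b g by (intro K.finsum_cong' refl) (auto intro!: K.finsum_closed)
    finally show ?thesis .
  qed
  then have "(\<Oplus>\<^bsub>K\<^esub>u\<in>carrier M. (a \<otimes>\<^bsub>KM\<^esub> b) u \<otimes>\<^bsub>K\<^esub> g u) =
      (\<Oplus>\<^bsub>K\<^esub>u\<in>carrier M. \<Oplus>\<^bsub>K\<^esub>y\<in>carrier M. \<Oplus>\<^bsub>K\<^esub>z\<in>carrier M. ?t u y z)"
    by simp
  \<comment> \<open>The sum over \<open>u\<close> is moved innermost, where the condition
    \<open>u = y z\<close> leaves a single term.\<close>
  also have "\<dots> = (\<Oplus>\<^bsub>K\<^esub>y\<in>carrier M. \<Oplus>\<^bsub>K\<^esub>u\<in>carrier M. \<Oplus>\<^bsub>K\<^esub>z\<in>carrier M. ?t u y z)"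
    using t by (intro K.finsum_swap finite_carrier) (auto intro!: K.finsum_closed)
  also have "\<dots> = (\<Oplus>\<^bsub>K\<^esub>y\<in>carrier M. \<Oplus>\<^bsub>K\<^esub>z\<in>carrier M. \<Oplus>\<^bsub>K\<^esub>u\<in>carrier M. ?t u y z)"
    using t by (intro K.finsum_cong' refl K.finsum_swap finite_carrier)
      (auto intro!: K.finsum_closed)
  also have "\<dots> = (\<Oplus>\<^bsub>K\<^esub>y\<in>carrier M. \<Oplus>\<^bsub>K\<^esub>z\<in>carrier M. a y \<otimes>\<^bsub>K\<^esub> b z \<otimes>\<^bsub>K\<^esub> g (y \<otimes>\<^bsub>M\<^esub> z))"
  proof -
    have "(\<Oplus>\<^bsub>K\<^esub>u\<in>carrier M. ?t u y z) = a y \<otimes>\<^bsub>K\<^esub> b z \<otimes>\<^bsub>K\<^esub> g (y \<otimes>\<^bsub>M\<^esub> z)"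
      if "y \<in> carrier M" "z \<in> carrier M" for y z
      using K.add.finprod_singleton_swap[of "y \<otimes>\<^bsub>M\<^esub> z" "carrier M"
          "\<lambda>u. a y \<otimes>\<^bsub>K\<^esub> b z \<otimes>\<^bsub>K\<^esub> g u"] that a b g finite_carrier by auto
    then show ?thesis
      using a b g by (intro K.finsum_cong' refl) (auto intro!: K.finsum_closed)
  qed
  finally show ?thesis .
qed

text \<open>For fixed \<open>z\<close> the inner sum is a pairing with \<open>a\<close>, so
  \<open>pairing_mult\<close> applies when \<open>a\<close> is itself a product;
  \<open>mult_eq_pairing_right\<close> does the same for the second factor.\<close>

lemma mult_eq_pairing_left:
  assumes a: "a \<in> carrier KM" and b: "b \<in> carrier KM"
  shows "(a \<otimes>\<^bsub>KM\<^esub> b) x = (\<Oplus>\<^bsub>K\<^esub>z\<in>carrier M. \<Oplus>\<^bsub>K\<^esub>y\<in>carrier M.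
    a y \<otimes>\<^bsub>K\<^esub> (if y \<otimes>\<^bsub>M\<^esub> z = x then b z else \<zero>\<^bsub>K\<^esub>))"
proof -
  note [simp] = coeff_closed[OF a] coeff_closed[OF b]
  have "(a \<otimes>\<^bsub>KM\<^esub> b) x = (\<Oplus>\<^bsub>K\<^esub>z\<in>carrier M. \<Oplus>\<^bsub>K\<^esub>y\<in>carrier M.
      if y \<otimes>\<^bsub>M\<^esub> z = x then a y \<otimes>\<^bsub>K\<^esub> b z else \<zero>\<^bsub>K\<^esub>)"
    unfolding mult_eq[OF a b] using a b by (intro K.finsum_swap finite_carrier) auto
  also have "\<dots> = (\<Oplus>\<^bsub>K\<^esub>z\<in>carrier M. \<Oplus>\<^bsub>K\<^esub>y\<in>carrier M.
      a y \<otimes>\<^bsub>K\<^esub> (if y \<otimes>\<^bsub>M\<^esub> z = x then b z else \<zero>\<^bsub>K\<^esub>))"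
    using a b by (intro K.finsum_cong' refl) (auto intro!: K.finsum_closed)
  finally show ?thesis .
qed

lemma mult_eq_pairing_right:
  assumes a: "a \<in> carrier KM" and b: "b \<in> carrier KM"
  shows "(a \<otimes>\<^bsub>KM\<^esub> b) x = (\<Oplus>\<^bsub>K\<^esub>y\<in>carrier M. a y \<otimes>\<^bsub>K\<^esub>
    (\<Oplus>\<^bsub>K\<^esub>z\<in>carrier M. b z \<otimes>\<^bsub>K\<^esub> (if y \<otimes>\<^bsub>M\<^esub> z = x then \<one>\<^bsub>K\<^esub> else \<zero>\<^bsub>K\<^esub>)))"
proof -
  note [simp] = coeff_closed[OF a] coeff_closed[OF b]
  have "(\<Oplus>\<^bsub>K\<^esub>z\<in>carrier M. if y \<otimes>\<^bsub>M\<^esub> z = x then a y \<otimes>\<^bsub>K\<^esub> b z else \<zero>\<^bsub>K\<^esub>) = a y \<otimes>\<^bsub>K\<^esub>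
      (\<Oplus>\<^bsub>K\<^esub>z\<in>carrier M. b z \<otimes>\<^bsub>K\<^esub> (if y \<otimes>\<^bsub>M\<^esub> z = x then \<one>\<^bsub>K\<^esub> else \<zero>\<^bsub>K\<^esub>))" for y
  proof -
    have "a y \<otimes>\<^bsub>K\<^esub> (\<Oplus>\<^bsub>K\<^esub>z\<in>carrier M. b z \<otimes>\<^bsub>K\<^esub> (if y \<otimes>\<^bsub>M\<^esub> z = x then \<one>\<^bsub>K\<^esub> else \<zero>\<^bsub>K\<^esub>)) =
       (\<Oplus>\<^bsub>K\<^esub>z\<in>carrier M. a y \<otimes>\<^bsub>K\<^esub> (b z \<otimes>\<^bsub>K\<^esub> (if y \<otimes>\<^bsub>M\<^esub> z = x then \<one>\<^bsub>K\<^esub> else \<zero>\<^bsub>K\<^esub>)))"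
      using a b by (intro K.finsum_rdistr finite_carrier) auto
    also have "\<dots> = (\<Oplus>\<^bsub>K\<^esub>z\<in>carrier M. if y \<otimes>\<^bsub>M\<^esub> z = x then a y \<otimes>\<^bsub>K\<^esub> b z else \<zero>\<^bsub>K\<^esub>)"
      using a b by (intro K.finsum_cong' refl) auto
    finally show ?thesis by simp
  qed
  then show ?thesis
    unfolding mult_eq[OF a b] by simp
qed

text \<open>Both bracketings become the sum of \<open>?t p q z\<close> over all triples: the left
  one by pairing with the first factor, the right one by pairing with the second. The two conditions
  on a triple agree by associativity in \<open>M\<close>.\<close>

lemma mult_assoc:
  assumes a: "a \<in> carrier KM" and b: "b \<in> carrier KM" and c: "c \<in> carrier KM"
  shows "(a \<otimes>\<^bsub>KM\<^esub> b) \<otimes>\<^bsub>KM\<^esub> c = a \<otimes>\<^bsub>KM\<^esub> (b \<otimes>\<^bsub>KM\<^esub> c)"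
proof
  note [simp] = coeff_closed[OF a] coeff_closed[OF b] coeff_closed[OF c]
  fix x
  let ?i = "\<lambda>y :: 'm. if y = x then \<one>\<^bsub>K\<^esub> else \<zero>\<^bsub>K\<^esub>"
  let ?t = "\<lambda>p q z. a p \<otimes>\<^bsub>K\<^esub> b q \<otimes>\<^bsub>K\<^esub> (c z \<otimes>\<^bsub>K\<^esub> ?i (p \<otimes>\<^bsub>M\<^esub> q \<otimes>\<^bsub>M\<^esub> z))"
  have t: "?t p q z \<in> carrier K" for p q z
    using a b c by auto
  have "((a \<otimes>\<^bsub>KM\<^esub> b) \<otimes>\<^bsub>KM\<^esub> c) x = (\<Oplus>\<^bsub>K\<^esub>z\<in>carrier M. \<Oplus>\<^bsub>K\<^esub>u\<in>carrier M.
      (a \<otimes>\<^bsub>KM\<^esub> b) u \<otimes>\<^bsub>K\<^esub> (if u \<otimes>\<^bsub>M\<^esub> z = x then c z else \<zero>\<^bsub>K\<^esub>))"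
    using a b c by (intro mult_eq_pairing_left mult_closed)
  also have "\<dots> = (\<Oplus>\<^bsub>K\<^esub>z\<in>carrier M. \<Oplus>\<^bsub>K\<^esub>p\<in>carrier M. \<Oplus>\<^bsub>K\<^esub>q\<in>carrier M.
      a p \<otimes>\<^bsub>K\<^esub> b q \<otimes>\<^bsub>K\<^esub> (if p \<otimes>\<^bsub>M\<^esub> q \<otimes>\<^bsub>M\<^esub> z = x then c z else \<zero>\<^bsub>K\<^esub>))"
    using a b c by (intro K.finsum_cong' refl pairing_mult) (auto intro!: K.finsum_closed)
  also have "\<dots> = (\<Oplus>\<^bsub>K\<^esub>z\<in>carrier M. \<Oplus>\<^bsub>K\<^esub>p\<in>carrier M. \<Oplus>\<^bsub>K\<^esub>q\<in>carrier M. ?t p q z)"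
    using a b c by (intro K.finsum_cong' refl) (auto intro!: K.finsum_closed)
  also have "\<dots> = (\<Oplus>\<^bsub>K\<^esub>p\<in>carrier M. \<Oplus>\<^bsub>K\<^esub>z\<in>carrier M. \<Oplus>\<^bsub>K\<^esub>q\<in>carrier M. ?t p q z)"
    using t by (intro K.finsum_swap finite_carrier) (auto intro!: K.finsum_closed)
  also have "\<dots> = (\<Oplus>\<^bsub>K\<^esub>p\<in>carrier M. \<Oplus>\<^bsub>K\<^esub>q\<in>carrier M. \<Oplus>\<^bsub>K\<^esub>z\<in>carrier M. ?t p q z)"
    using t by (intro K.finsum_cong' refl K.finsum_swap finite_carrier)
      (auto intro!: K.finsum_closed)
  also have "\<dots> = (\<Oplus>\<^bsub>K\<^esub>p\<in>carrier M. a p \<otimes>\<^bsub>K\<^esub> (\<Oplus>\<^bsub>K\<^esub>q\<in>carrier M. \<Oplus>\<^bsub>K\<^esub>z\<in>carrier M.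
      b q \<otimes>\<^bsub>K\<^esub> c z \<otimes>\<^bsub>K\<^esub> ?i (p \<otimes>\<^bsub>M\<^esub> (q \<otimes>\<^bsub>M\<^esub> z))))"
  proof (intro K.finsum_cong' refl)
    fix p assume p: "p \<in> carrier M"
    have "a p \<otimes>\<^bsub>K\<^esub> (\<Oplus>\<^bsub>K\<^esub>q\<in>carrier M. \<Oplus>\<^bsub>K\<^esub>z\<in>carrier M.
        b q \<otimes>\<^bsub>K\<^esub> c z \<otimes>\<^bsub>K\<^esub> ?i (p \<otimes>\<^bsub>M\<^esub> (q \<otimes>\<^bsub>M\<^esub> z))) =
      (\<Oplus>\<^bsub>K\<^esub>q\<in>carrier M. a p \<otimes>\<^bsub>K\<^esub> (\<Oplus>\<^bsub>K\<^esub>z\<in>carrier M.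
        b q \<otimes>\<^bsub>K\<^esub> c z \<otimes>\<^bsub>K\<^esub> ?i (p \<otimes>\<^bsub>M\<^esub> (q \<otimes>\<^bsub>M\<^esub> z))))"
      using a b c by (intro K.finsum_rdistr finite_carrier) (auto intro!: K.finsum_closed)
    also have "\<dots> = (\<Oplus>\<^bsub>K\<^esub>q\<in>carrier M. \<Oplus>\<^bsub>K\<^esub>z\<in>carrier M. a p \<otimes>\<^bsub>K\<^esub> (
        b q \<otimes>\<^bsub>K\<^esub> c z \<otimes>\<^bsub>K\<^esub> ?i (p \<otimes>\<^bsub>M\<^esub> (q \<otimes>\<^bsub>M\<^esub> z))))"
      using a b c by (intro K.finsum_cong' refl K.finsum_rdistr finite_carrier)
        (auto intro!: K.finsum_closed)
    also have "\<dots> = (\<Oplus>\<^bsub>K\<^esub>q\<in>carrier M. \<Oplus>\<^bsub>K\<^esub>z\<in>carrier M. ?t p q z)"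
      using a b c p by (intro K.finsum_cong' refl)
        (auto intro!: K.finsum_closed simp: K.m_assoc M.m_assoc)
    finally show "(\<Oplus>\<^bsub>K\<^esub>q\<in>carrier M. \<Oplus>\<^bsub>K\<^esub>z\<in>carrier M. ?t p q z) =
      a p \<otimes>\<^bsub>K\<^esub> (\<Oplus>\<^bsub>K\<^esub>q\<in>carrier M. \<Oplus>\<^bsub>K\<^esub>z\<in>carrier M.
        b q \<otimes>\<^bsub>K\<^esub> c z \<otimes>\<^bsub>K\<^esub> ?i (p \<otimes>\<^bsub>M\<^esub> (q \<otimes>\<^bsub>M\<^esub> z)))" by simp
  qed (use a b c in \<open>auto intro!: K.finsum_closed\<close>)
  also have "\<dots> = (\<Oplus>\<^bsub>K\<^esub>p\<in>carrier M. a p \<otimes>\<^bsub>K\<^esub> (\<Oplus>\<^bsub>K\<^esub>u\<in>carrier M.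
      (b \<otimes>\<^bsub>KM\<^esub> c) u \<otimes>\<^bsub>K\<^esub> ?i (p \<otimes>\<^bsub>M\<^esub> u)))"
    using b c by (subst pairing_mult) auto
  also have "\<dots> = (a \<otimes>\<^bsub>KM\<^esub> (b \<otimes>\<^bsub>KM\<^esub> c)) x"
    using a b c by (intro mult_eq_pairing_right[symmetric] mult_closed)
  finally show "((a \<otimes>\<^bsub>KM\<^esub> b) \<otimes>\<^bsub>KM\<^esub> c) x = (a \<otimes>\<^bsub>KM\<^esub> (b \<otimes>\<^bsub>KM\<^esub> c)) x" .
qed

lemma add_apply: "(a \<oplus>\<^bsub>KM\<^esub> b) x = a x \<oplus>\<^bsub>K\<^esub> b x"
  by (simp add: monoid_algebra_def)

lemma zero_apply: "\<zero>\<^bsub>KM\<^esub> x = \<zero>\<^bsub>K\<^esub>"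
  by (simp add: monoid_algebra_def)

lemma one_apply: "\<one>\<^bsub>KM\<^esub> x = (if x = \<one>\<^bsub>M\<^esub> then \<one>\<^bsub>K\<^esub> else \<zero>\<^bsub>K\<^esub>)"
  by (simp add: monoid_algebra_def)

lemma one_closed: "\<one>\<^bsub>KM\<^esub> \<in> carrier KM"
  unfolding carrier_iff by (auto simp: one_apply)

text \<open>The point \<open>x\<close> is unrestricted because outside \<open>carrier M\<close> both
  the sum and \<open>a x\<close> are zero.\<close>

lemma finsum_delta:
  assumes a: "a \<in> carrier KM"
  shows "(\<Oplus>\<^bsub>K\<^esub>z\<in>carrier M. if x = z then a z else \<zero>\<^bsub>K\<^esub>) = a x"
proof (cases "x \<in> carrier M")
  case True
  then show ?thesis
    using coeff_closed[OF a] finite_carrier by (intro K.finsum_singleton) auto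
qed (use a in \<open>auto simp: carrier_iff intro!: K.add.finprod_one_eqI\<close>)

text \<open>Elements supported at the identity are the scalars inside the algebra. The rule serves
  the left unit law, the construction of inverses, and the scalar a(1) that multiplies e.\<close>

lemma mult_supported_one:
  assumes a: "a \<in> carrier KM" and b: "b \<in> carrier KM" and supp: "\<And>y. y \<noteq> \<one>\<^bsub>M\<^esub> \<Longrightarrow> a y = \<zero>\<^bsub>K\<^esub>"
  shows "(a \<otimes>\<^bsub>KM\<^esub> b) x = a \<one>\<^bsub>M\<^esub> \<otimes>\<^bsub>K\<^esub> b x"
proof -
  note [simp] = coeff_closed[OF a] coeff_closed[OF b]
  let ?f = "\<lambda>y. a y \<otimes>\<^bsub>K\<^esub> (\<Oplus>\<^bsub>K\<^esub>z\<in>carrier M. b z \<otimes>\<^bsub>K\<^esub>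
    (if y \<otimes>\<^bsub>M\<^esub> z = x then \<one>\<^bsub>K\<^esub> else \<zero>\<^bsub>K\<^esub>))"
  have c: "?f y \<in> carrier K" for y
    by (auto intro!: K.finsum_closed)
  have "(a \<otimes>\<^bsub>KM\<^esub> b) x = (\<Oplus>\<^bsub>K\<^esub>y\<in>carrier M. if \<one>\<^bsub>M\<^esub> = y then ?f y else \<zero>\<^bsub>K\<^esub>)"
    unfolding mult_eq_pairing_right[OF a b] using c supp
    by (intro K.finsum_cong' refl) (auto intro!: K.finsum_closed)
  also have "\<dots> = ?f \<one>\<^bsub>M\<^esub>"
    using c finite_carrier by (intro K.finsum_singleton) auto
  also have "(\<Oplus>\<^bsub>K\<^esub>z\<in>carrier M. b z \<otimes>\<^bsub>K\<^esub> (if \<one>\<^bsub>M\<^esub> \<otimes>\<^bsub>M\<^esub> z = x then \<one>\<^bsub>K\<^esub> else \<zero>\<^bsub>K\<^esub>)) =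
      (\<Oplus>\<^bsub>K\<^esub>z\<in>carrier M. if x = z then b z else \<zero>\<^bsub>K\<^esub>)"
    by (intro K.finsum_cong' refl) auto
  finally show ?thesis
    by (simp only: finsum_delta[OF b])
qed

lemma one_mult:
  assumes a: "a \<in> carrier KM"
  shows "\<one>\<^bsub>KM\<^esub> \<otimes>\<^bsub>KM\<^esub> a = a"
  using coeff_closed[OF a]
  by (intro ext, subst mult_supported_one[OF one_closed a]) (auto simp: one_apply)

lemma mult_one:
  assumes a: "a \<in> carrier KM"
  shows "a \<otimes>\<^bsub>KM\<^esub> \<one>\<^bsub>KM\<^esub> = a"
proof
  note [simp] = coeff_closed[OF a]
  fix x
  have "(a \<otimes>\<^bsub>KM\<^esub> \<one>\<^bsub>KM\<^esub>) x = (\<Oplus>\<^bsub>K\<^esub>y\<in>carrier M. \<Oplus>\<^bsub>K\<^esub>z\<in>carrier M.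
      if \<one>\<^bsub>M\<^esub> = z then if x = y then a y else \<zero>\<^bsub>K\<^esub> else \<zero>\<^bsub>K\<^esub>)"
    unfolding mult_eq[OF a one_closed] using a
    by (intro K.finsum_cong') (auto simp: one_apply intro!: K.finsum_closed K.finsum_cong')
  also have "\<dots> = (\<Oplus>\<^bsub>K\<^esub>y\<in>carrier M. if x = y then a y else \<zero>\<^bsub>K\<^esub>)"
    using a finite_carrier
    by (intro K.finsum_cong' refl K.finsum_singleton[where f = "\<lambda>_. if x = y then a y else \<zero>\<^bsub>K\<^esub>" for y]) auto
  also have "\<dots> = a x"
    by (rule finsum_delta[OF a])
  finally show "(a \<otimes>\<^bsub>KM\<^esub> \<one>\<^bsub>KM\<^esub>) x = a x" .
qed

lemma monoid_algebra_ring: "ring KM"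
proof (rule ringI)
  show "abelian_group KM"
  proof (rule abelian_groupI)
    fix a assume a: "a \<in> carrier KM"
    have "(\<lambda>x. \<ominus>\<^bsub>K\<^esub> a x) \<in> carrier KM"
      using a unfolding carrier_iff by simp
    moreover have "(\<lambda>x. \<ominus>\<^bsub>K\<^esub> a x) \<oplus>\<^bsub>KM\<^esub> a = \<zero>\<^bsub>KM\<^esub>"
      using a by (simp add: fun_eq_iff add_apply zero_apply K.l_neg coeff_closed)
    ultimately show "\<exists>b\<in>carrier KM. b \<oplus>\<^bsub>KM\<^esub> a = \<zero>\<^bsub>KM\<^esub>"
      by blast
  qed (auto simp: carrier_iff add_apply zero_apply fun_eq_iff K.a_ac)
  show "Group.monoid KM"
    by (rule monoidI) (simp_all add: mult_closed one_closed mult_assoc one_mult mult_one)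
next
  fix a b c assume abc: "a \<in> carrier KM" "b \<in> carrier KM" "c \<in> carrier KM"
  note [simp] = coeff_closed[OF abc(1)] coeff_closed[OF abc(2)] coeff_closed[OF abc(3)]
  have ab: "a \<oplus>\<^bsub>KM\<^esub> b \<in> carrier KM"
    using abc by (auto simp: carrier_iff add_apply)
  have *: "(\<Oplus>\<^bsub>K\<^esub>y\<in>carrier M. \<Oplus>\<^bsub>K\<^esub>z\<in>carrier M. f y z \<oplus>\<^bsub>K\<^esub> g y z) =
      (\<Oplus>\<^bsub>K\<^esub>y\<in>carrier M. \<Oplus>\<^bsub>K\<^esub>z\<in>carrier M. f y z) \<oplus>\<^bsub>K\<^esub>
      (\<Oplus>\<^bsub>K\<^esub>y\<in>carrier M. \<Oplus>\<^bsub>K\<^esub>z\<in>carrier M. g y z)"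
    if "\<And>y z. f y z \<in> carrier K" "\<And>y z. g y z \<in> carrier K" for f g
    using that by (simp add: K.finsum_addf Pi_iff K.finsum_closed)
  show "(a \<oplus>\<^bsub>KM\<^esub> b) \<otimes>\<^bsub>KM\<^esub> c = a \<otimes>\<^bsub>KM\<^esub> c \<oplus>\<^bsub>KM\<^esub> b \<otimes>\<^bsub>KM\<^esub> c"
  proof
    fix x
    show "((a \<oplus>\<^bsub>KM\<^esub> b) \<otimes>\<^bsub>KM\<^esub> c) x = (a \<otimes>\<^bsub>KM\<^esub> c \<oplus>\<^bsub>KM\<^esub> b \<otimes>\<^bsub>KM\<^esub> c) x"
      unfolding add_apply[of "a \<otimes>\<^bsub>KM\<^esub> c"] mult_eq[OF ab abc(3)] mult_eq[OF abc(1,3)] mult_eq[OF abc(2,3)]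
      by (subst *[symmetric], simp, simp, intro K.finsum_cong' refl)
         (use abc in \<open>auto simp: add_apply K.l_distr simp del: K.finsum_addf intro!: K.finsum_closed\<close>)
  qed
  show "c \<otimes>\<^bsub>KM\<^esub> (a \<oplus>\<^bsub>KM\<^esub> b) = c \<otimes>\<^bsub>KM\<^esub> a \<oplus>\<^bsub>KM\<^esub> c \<otimes>\<^bsub>KM\<^esub> b"
  proof
    fix x
    show "(c \<otimes>\<^bsub>KM\<^esub> (a \<oplus>\<^bsub>KM\<^esub> b)) x = (c \<otimes>\<^bsub>KM\<^esub> a \<oplus>\<^bsub>KM\<^esub> c \<otimes>\<^bsub>KM\<^esub> b) x"
      unfolding add_apply[of "c \<otimes>\<^bsub>KM\<^esub> a"] mult_eq[OF abc(3) ab] mult_eq[OF abc(3,1)] mult_eq[OF abc(3,2)]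
      by (subst *[symmetric], simp, simp, intro K.finsum_cong' refl)
         (use abc in \<open>auto simp: add_apply K.r_distr simp del: K.finsum_addf intro!: K.finsum_closed\<close>)
  qed
qed

end

section \<open>Restriction of scalars, the regular module and criteria for injectivity\<close>

section \<open>Modules\<close>

text \<open>The record update has the shape of \<open>Ind\<close>, which restricts scalars along the
  projection of kM onto kG.\<close>

lemma left_module_restrict_scalars:
  assumes "ring R" "left_module R' W" and \<phi>: "\<phi> \<in> ring_hom R R'"
  shows "left_module R (W\<lparr>smult := \<lambda>r w. \<phi> r \<odot>\<^bsub>W\<^esub> w\<rparr>)"
proof -
  interpret R: ring R by fact
  interpret W: left_module R' W by fact
  have "abelian_group (W\<lparr>smult := \<lambda>r w. \<phi> r \<odot>\<^bsub>W\<^esub> w\<rparr>)"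
    by (rule abelian_groupI) (auto simp: W.M.a_ac intro: W.M.l_neg W.M.a_inv_closed)
  then show ?thesis
    using \<phi>
    by (intro left_module.intro left_module_axioms.intro R.ring_axioms)
       (auto simp: ring_hom_closed ring_hom_add ring_hom_mult ring_hom_one
         W.smult_l_distr W.smult_r_distr W.smult_assoc1)
qed

lemma regular_module_left_module:
  "ring R \<Longrightarrow> left_module R (ideal_as_module R (carrier R))"
  by (rule ideal_as_module_left_module)
     (auto simp: ring.ring_simprules monoid.m_closed ring.is_monoid)

text \<open>The regular module is free on \<open>\<one>\<close>, so a lift of \<open>f\<close>
  amounts to a preimage of the value of \<open>f\<close> at \<open>\<one>\<close>.\<close>

lemma regular_module_projective:
  fixes R :: "('r, 's) ring_scheme"
  assumes "ring R"
  shows "projective_module TYPE('a) TYPE('b) R (ideal_as_module R (carrier R))"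
  unfolding projective_module_def
proof (intro conjI allI impI)
  let ?P = "ideal_as_module R (carrier R)"
  interpret R: ring R by fact
  show P: "left_module R ?P"
    using assms by (rule regular_module_left_module)
  fix A :: "('r, 'a) module" and B :: "('r, 'b) module" and q f
  assume "left_module R A \<and> left_module R B \<and> q \<in> left_module_hom R A B \<and>
    q ` carrier A = carrier B \<and> f \<in> left_module_hom R ?P B"
  then have A: "left_module R A" and q: "q \<in> left_module_hom R A B"
    and surj: "q ` carrier A = carrier B" and f: "f \<in> left_module_hom R ?P B"
    by auto
  interpret A: left_module R A by fact
  have "f \<one>\<^bsub>R\<^esub> \<in> carrier B"
    using left_module_hom_closed[OF f] by (simp add: ideal_as_module_def)
  then obtain a where a: "a \<in> carrier A" "q a = f \<one>\<^bsub>R\<^esub>"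
    using surj by (metis imageE)
  have "(\<lambda>r. r \<odot>\<^bsub>A\<^esub> a) \<in> left_module_hom R ?P A"
    using a by (auto simp: left_module_hom_def ideal_as_module_def A.smult_l_distr A.smult_assoc1)
  moreover have "q (r \<odot>\<^bsub>A\<^esub> a) = f r" if "r \<in> carrier R" for r
    using left_module_hom_smult[OF q that a(1)] left_module_hom_smult[OF f that, of "\<one>\<^bsub>R\<^esub>"] that a
    by (simp add: ideal_as_module_def)
  ultimately show "\<exists>g\<in>left_module_hom R ?P A. \<forall>x\<in>carrier ?P. q (g x) = f x"
    by (auto simp: ideal_as_module_def intro!: bexI[of _ "\<lambda>r. r \<odot>\<^bsub>A\<^esub> a"])
qed

text \<open>A nonzero submodule contains an invertible element and with it \<open>\<one>\<close>, so
  two nonzero submodules cannot meet in zero.\<close>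

lemma regular_module_indecomposable:
  assumes "ring R" and "\<one>\<^bsub>R\<^esub> \<noteq> \<zero>\<^bsub>R\<^esub>"
    and inverse: "\<And>x. \<lbrakk>x \<in> carrier R; x \<noteq> \<zero>\<^bsub>R\<^esub>\<rbrakk> \<Longrightarrow> x \<in> Units R"
  shows "indecomposable_module R (ideal_as_module R (carrier R))"
  unfolding indecomposable_module_def
proof (intro conjI allI impI)
  let ?P = "ideal_as_module R (carrier R)"
  interpret R: ring R by fact
  show "left_module R ?P"
    using assms(1) by (rule regular_module_left_module)
  show "carrier ?P \<noteq> {\<zero>\<^bsub>?P\<^esub>}"
    using R.one_closed assms(2) by (auto simp: ideal_as_module_def)
  fix A B
  assume AB: "submodule A R ?P \<and> submodule B R ?P \<and> A \<inter> B = {\<zero>\<^bsub>?P\<^esub>} \<and> A <+>\<^bsub>?P\<^esub> B = carrier ?P"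
  have one: "\<one>\<^bsub>R\<^esub> \<in> S" if S: "submodule S R ?P" "S \<noteq> {\<zero>\<^bsub>?P\<^esub>}" for S
  proof -
    interpret S: submodule S R ?P by (rule S(1))
    have "\<zero>\<^bsub>R\<^esub> \<in> S" "S \<subseteq> carrier R"
      using S.one_closed S.subset by (simp_all add: ideal_as_module_def)
    then obtain x where x: "x \<in> S" "x \<in> carrier R" "x \<noteq> \<zero>\<^bsub>R\<^esub>"
      using S(2) by (auto simp: ideal_as_module_def)
    then have "inv\<^bsub>R\<^esub> x \<otimes>\<^bsub>R\<^esub> x = \<one>\<^bsub>R\<^esub>" "inv\<^bsub>R\<^esub> x \<in> carrier R"
      using inverse by auto
    then show ?thesis
      using S.smult_closed[of "inv\<^bsub>R\<^esub> x" x] x by (simp add: ideal_as_module_def)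
  qed
  show "A = {\<zero>\<^bsub>?P\<^esub>} \<or> B = {\<zero>\<^bsub>?P\<^esub>}"
    using AB one[of A] one[of B] assms(2) by (auto simp: ideal_as_module_def)
qed

text \<open>The Zorn half of Baer's criterion, with the one-element extension left as a hypothesis.
  That step can then be carried out in the test module \<open>B\<close> itself, without a passage
  through left ideals.\<close>

lemma injective_moduleI_extend:
  fixes R :: "('r, 's) ring_scheme" and W :: "('r, 'w) module"
  assumes W: "left_module R W"
    and extend: "\<And>(B :: ('r, 'b) module) G b. \<lbrakk>left_module R B; hom_graph R B W G; b \<in> carrier B\<rbrakk> \<Longrightarrow>
      \<exists>G'. hom_graph R B W G' \<and> G \<subseteq> G' \<and> b \<in> fst ` G'"
  shows "injective_module TYPE('a) TYPE('b) R W"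
  unfolding injective_module_def
proof (intro conjI allI impI)
  fix A :: "('r, 'a) module" and B :: "('r, 'b) module" and i f
  assume "left_module R A \<and> left_module R B \<and> i \<in> left_module_hom R A B \<and>
    inj_on i (carrier A) \<and> f \<in> left_module_hom R A W"
  then have A: "left_module R A" and B: "left_module R B" and i: "i \<in> left_module_hom R A B"
    and inj: "inj_on i (carrier A)" and f: "f \<in> left_module_hom R A W"
    by auto
  interpret A: left_module R A by fact
  define G0 where "G0 = (\<lambda>x. (i x, f x)) ` carrier A"
  have G0: "(i x, f x) \<in> G0" if "x \<in> carrier A" for x
    using that by (auto simp: G0_def)
  have "hom_graph R B W G0"
    unfolding hom_graph_def
  proof (intro conjI allI impI ballI)
    show "G0 \<subseteq> carrier B \<times> carrier W"
      using left_module_hom_closed[OF i] left_module_hom_closed[OF f] by (auto simp: G0_def)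
    show "(\<zero>\<^bsub>B\<^esub>, \<zero>\<^bsub>W\<^esub>) \<in> G0"
      using G0[of "\<zero>\<^bsub>A\<^esub>"] left_module_hom_zero[OF A B i] left_module_hom_zero[OF A W f] by simp
    show "(x \<oplus>\<^bsub>B\<^esub> x', y \<oplus>\<^bsub>W\<^esub> y') \<in> G0" if xy: "(x, y) \<in> G0 \<and> (x', y') \<in> G0" for x y x' y'
    proof -
      obtain a a' where "a \<in> carrier A" "a' \<in> carrier A" "x = i a" "y = f a" "x' = i a'" "y' = f a'"
        using xy by (auto simp: G0_def)
      then show ?thesis
        using G0[of "a \<oplus>\<^bsub>A\<^esub> a'"] left_module_hom_add[OF i] left_module_hom_add[OF f] by simp
    qed
    show "(r \<odot>\<^bsub>B\<^esub> x, r \<odot>\<^bsub>W\<^esub> y) \<in> G0" if r: "r \<in> carrier R" and xy: "(x, y) \<in> G0" for r x y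
    proof -
      obtain a where "a \<in> carrier A" "x = i a" "y = f a"
        using xy by (auto simp: G0_def)
      then show ?thesis
        using r G0[of "r \<odot>\<^bsub>A\<^esub> a"] left_module_hom_smult[OF i] left_module_hom_smult[OF f] by simp
    qed
    show "y = \<zero>\<^bsub>W\<^esub>" if y: "(\<zero>\<^bsub>B\<^esub>, y) \<in> G0" for y
    proof -
      obtain a where a: "a \<in> carrier A" "i a = i \<zero>\<^bsub>A\<^esub>" "y = f a"
        using y left_module_hom_zero[OF A B i] by (auto simp: G0_def)
      then have "a = \<zero>\<^bsub>A\<^esub>"
        using inj by (auto dest: inj_onD)
      then show ?thesis
        using a left_module_hom_zero[OF A W f] by simp
    qed
  qed
  define \<G> where "\<G> = {G. hom_graph R B W G \<and> G0 \<subseteq> G}"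
  have "\<exists>G\<in>\<G>. \<forall>U\<in>\<G>. G \<subseteq> U \<longrightarrow> U = G"
  proof (rule subset_Zorn_nonempty)
    show "\<G> \<noteq> {}"
      using \<open>hom_graph R B W G0\<close> by (auto simp: \<G>_def)
    show "\<Union>\<C> \<in> \<G>" if "\<C> \<noteq> {}" "subset.chain \<G> \<C>" for \<C>
    proof -
      have "subset.chain {G. hom_graph R B W G} \<C>"
        using that(2) by (auto simp: subset_chain_def \<G>_def)
      moreover have "G0 \<subseteq> \<Union>\<C>"
        using that by (fastforce simp: subset_chain_def \<G>_def)
      ultimately show ?thesis
        using hom_graph_Union[OF _ that(1)] by (simp add: \<G>_def)
    qed
  qed
  then obtain G where G: "hom_graph R B W G" "G0 \<subseteq> G"
    and max: "\<And>U. \<lbrakk>hom_graph R B W U; G0 \<subseteq> U; G \<subseteq> U\<rbrakk> \<Longrightarrow> U = G"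
    by (auto simp: \<G>_def)
  have "\<exists>y. (b, y) \<in> G" if "b \<in> carrier B" for b
    using extend[OF B G(1) that] max G(2) by fastforce
  then obtain g where g: "\<And>b. b \<in> carrier B \<Longrightarrow> (b, g b) \<in> G"
    by metis
  have gI: "g x = y" if "(x, y) \<in> G" for x y
  proof -
    have "x \<in> carrier B"
      using that G(1) by (auto simp: hom_graph_def)
    then show ?thesis
      using hom_graph_unique[OF B W G(1) g that] by blast
  qed
  have "g \<in> left_module_hom R B W"
    unfolding left_module_hom_def
  proof (intro CollectI conjI ballI Pi_I)
    show "g x \<in> carrier W" if "x \<in> carrier B" for x
      using g[OF that] G(1) by (auto simp: hom_graph_def)
    show "g (x \<oplus>\<^bsub>B\<^esub> y) = g x \<oplus>\<^bsub>W\<^esub> g y" if "x \<in> carrier B" "y \<in> carrier B" for x y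
      using g[OF that(1)] g[OF that(2)] G(1) unfolding hom_graph_def by (intro gI) blast
    show "g (r \<odot>\<^bsub>B\<^esub> x) = r \<odot>\<^bsub>W\<^esub> g x" if "r \<in> carrier R" "x \<in> carrier B" for r x
      using g[OF that(2)] that(1) G(1) unfolding hom_graph_def by (intro gI) blast
  qed
  moreover have "g (i x) = f x" if "x \<in> carrier A" for x
    using G(2) G0[OF that] by (intro gI) auto
  ultimately show "\<exists>g\<in>left_module_hom R B W. \<forall>x\<in>carrier A. g (i x) = f x"
    by blast
qed (rule W)

text \<open>Since \<open>e\<close> acts as the identity on \<open>W\<close>, a partial homomorphism
  takes the same value at \<open>x\<close> and at \<open>e x\<close>. Single-valuedness of the
  extended graph can therefore be tested after multiplying by \<open>e\<close>, which turns
  \<open>r b\<close> into \<open>\<phi> r\<close> times \<open>e b\<close>. As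
  \<open>\<phi> r\<close> is zero or invertible, it acts like a scalar from a field, and the
  extension step becomes the one for linear functionals.\<close>

lemma injective_moduleI_absorbing:
  fixes R :: "('r, 's) ring_scheme" and W :: "('r, 'w) module"
  assumes W: "left_module R W" and e: "e \<in> carrier R"
    and eW: "\<And>w. w \<in> carrier W \<Longrightarrow> e \<odot>\<^bsub>W\<^esub> w = w"
    and \<phi>: "\<And>r. r \<in> carrier R \<Longrightarrow> \<phi> r = \<zero>\<^bsub>R\<^esub> \<or> \<phi> r \<in> Units R"
    and \<phi>e: "\<And>r. r \<in> carrier R \<Longrightarrow> e \<otimes>\<^bsub>R\<^esub> r = \<phi> r \<otimes>\<^bsub>R\<^esub> e"
    and \<phi>W: "\<And>r w. \<lbrakk>r \<in> carrier R; w \<in> carrier W\<rbrakk> \<Longrightarrow> r \<odot>\<^bsub>W\<^esub> w = \<phi> r \<odot>\<^bsub>W\<^esub> w"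
  shows "injective_module TYPE('a) TYPE('b) R W"
proof (rule injective_moduleI_extend[OF W])
  fix B :: "('r, 'b) module" and G b
  assume B: "left_module R B" and G: "hom_graph R B W G" and b: "b \<in> carrier B"
  interpret B: left_module R B by fact
  interpret W: left_module R W by fact
  have Gsub: "x \<in> carrier B" "y \<in> carrier W" if "(x, y) \<in> G" for x y
    using G that by (auto simp: hom_graph_def)
  have Gzero: "(\<zero>\<^bsub>B\<^esub>, \<zero>\<^bsub>W\<^esub>) \<in> G"
    using G by (simp add: hom_graph_def)
  have Gadd: "(x \<oplus>\<^bsub>B\<^esub> x', y \<oplus>\<^bsub>W\<^esub> y') \<in> G" if "(x, y) \<in> G" "(x', y') \<in> G" for x y x' y'
    using G that unfolding hom_graph_def by blast
  have Gsm: "(r \<odot>\<^bsub>B\<^esub> x, r \<odot>\<^bsub>W\<^esub> y) \<in> G" if "r \<in> carrier R" "(x, y) \<in> G" for r x y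
    using G that unfolding hom_graph_def by blast
  have Guniq: "y = y'" if "(x, y) \<in> G" "(x, y') \<in> G" for x y y'
    using hom_graph_unique[OF B W G] that by blast
  \<comment> \<open>If \<open>e b\<close> is not in the domain of \<open>G\<close>, every \<open>c\<close> will do.\<close>
  obtain c where c: "c \<in> carrier W" and Gc: "\<And>y. (e \<odot>\<^bsub>B\<^esub> b, y) \<in> G \<Longrightarrow> y = c"
    using Guniq Gsub(2) W.M.zero_closed by metis
  define G' where "G' = {(x \<oplus>\<^bsub>B\<^esub> r \<odot>\<^bsub>B\<^esub> b, y \<oplus>\<^bsub>W\<^esub> r \<odot>\<^bsub>W\<^esub> c) | x y r. (x, y) \<in> G \<and> r \<in> carrier R}"
  have G'I: "(x', y') \<in> G'"
    if "(x, y) \<in> G" "r \<in> carrier R" "x' = x \<oplus>\<^bsub>B\<^esub> r \<odot>\<^bsub>B\<^esub> b" "y' = y \<oplus>\<^bsub>W\<^esub> r \<odot>\<^bsub>W\<^esub> c" for x y r x' y'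
    using that by (auto simp: G'_def)
  have G'E: thesis if "(x', y') \<in> G'"
    "\<And>x y r. \<lbrakk>(x, y) \<in> G; x \<in> carrier B; y \<in> carrier W; r \<in> carrier R;
      x' = x \<oplus>\<^bsub>B\<^esub> r \<odot>\<^bsub>B\<^esub> b; y' = y \<oplus>\<^bsub>W\<^esub> r \<odot>\<^bsub>W\<^esub> c\<rbrakk> \<Longrightarrow> thesis" for x' y' thesis
    using that Gsub unfolding G'_def by blast
  have "G \<subseteq> G'"
    using b c Gsub by (auto intro!: G'I[OF _ B.R.zero_closed])
  moreover have "(b, c) \<in> G'"
    using b c by (intro G'I[OF Gzero B.R.one_closed]) auto
  moreover have "hom_graph R B W G'"
    unfolding hom_graph_def
  proof (intro conjI allI impI ballI)
    show "G' \<subseteq> carrier B \<times> carrier W"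
      using b c by (auto elim!: G'E)
    show "(\<zero>\<^bsub>B\<^esub>, \<zero>\<^bsub>W\<^esub>) \<in> G'"
      using \<open>G \<subseteq> G'\<close> Gzero by blast
    show "(u \<oplus>\<^bsub>B\<^esub> u', v \<oplus>\<^bsub>W\<^esub> v') \<in> G'" if uv: "(u, v) \<in> G' \<and> (u', v') \<in> G'" for u v u' v'
    proof -
      obtain x y r x' y' r' where
        1: "(x, y) \<in> G" "r \<in> carrier R" "u = x \<oplus>\<^bsub>B\<^esub> r \<odot>\<^bsub>B\<^esub> b" "v = y \<oplus>\<^bsub>W\<^esub> r \<odot>\<^bsub>W\<^esub> c" and
        2: "(x', y') \<in> G" "r' \<in> carrier R" "u' = x' \<oplus>\<^bsub>B\<^esub> r' \<odot>\<^bsub>B\<^esub> b" "v' = y' \<oplus>\<^bsub>W\<^esub> r' \<odot>\<^bsub>W\<^esub> c"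
        using uv by (elim conjE G'E) blast
      show ?thesis
        using Gsub[OF 1(1)] Gsub[OF 2(1)] 1(2-4) 2(2-4) b c
        by (intro G'I[OF Gadd[OF 1(1) 2(1)] B.R.a_closed[OF 1(2) 2(2)]])
           (simp_all add: B.smult_l_distr W.smult_l_distr B.M.a_ac W.M.a_ac)
    qed
    show "(s \<odot>\<^bsub>B\<^esub> u, s \<odot>\<^bsub>W\<^esub> v) \<in> G'" if "s \<in> carrier R" "(u, v) \<in> G'" for s u v
      using that(2)
    proof (rule G'E)
      fix x y r
      assume 1: "(x, y) \<in> G" "x \<in> carrier B" "y \<in> carrier W" "r \<in> carrier R"
        "u = x \<oplus>\<^bsub>B\<^esub> r \<odot>\<^bsub>B\<^esub> b" "v = y \<oplus>\<^bsub>W\<^esub> r \<odot>\<^bsub>W\<^esub> c"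
      then show ?thesis
        using that(1) b c
        by (intro G'I[OF Gsm[OF that(1) 1(1)] B.R.m_closed[OF that(1) 1(4)]])
           (simp_all add: B.smult_r_distr W.smult_r_distr B.smult_assoc1 W.smult_assoc1)
    qed
    show "v = \<zero>\<^bsub>W\<^esub>" if "(\<zero>\<^bsub>B\<^esub>, v) \<in> G'" for v
      using that
    proof (rule G'E)
      fix x y r
      assume 1: "(x, y) \<in> G" "x \<in> carrier B" "y \<in> carrier W" "r \<in> carrier R"
        "\<zero>\<^bsub>B\<^esub> = x \<oplus>\<^bsub>B\<^esub> r \<odot>\<^bsub>B\<^esub> b" "v = y \<oplus>\<^bsub>W\<^esub> r \<odot>\<^bsub>W\<^esub> c"
      have \<phi>r: "\<phi> r \<in> carrier R"
        using \<phi>[OF 1(4)] by auto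
      have ex: "e \<odot>\<^bsub>B\<^esub> x \<in> carrier B" "e \<odot>\<^bsub>B\<^esub> b \<in> carrier B"
        using e 1 b by auto
      have "(e \<odot>\<^bsub>B\<^esub> x, e \<odot>\<^bsub>W\<^esub> y) \<in> G"
        using Gsm e 1(1) by blast
      then have Gex: "(e \<odot>\<^bsub>B\<^esub> x, y) \<in> G"
        using eW 1(3) by simp
      have "\<zero>\<^bsub>B\<^esub> = e \<odot>\<^bsub>B\<^esub> (x \<oplus>\<^bsub>B\<^esub> r \<odot>\<^bsub>B\<^esub> b)"
        using 1(5)[symmetric] e by simp
      also have "\<dots> = e \<odot>\<^bsub>B\<^esub> x \<oplus>\<^bsub>B\<^esub> (e \<otimes>\<^bsub>R\<^esub> r) \<odot>\<^bsub>B\<^esub> b"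
        using e 1(2,4) b by (simp add: B.smult_r_distr B.smult_assoc1)
      also have "\<dots> = e \<odot>\<^bsub>B\<^esub> x \<oplus>\<^bsub>B\<^esub> \<phi> r \<odot>\<^bsub>B\<^esub> (e \<odot>\<^bsub>B\<^esub> b)"
        using e \<phi>r 1(4) b by (simp add: \<phi>e B.smult_assoc1)
      finally have eq: "e \<odot>\<^bsub>B\<^esub> x \<oplus>\<^bsub>B\<^esub> \<phi> r \<odot>\<^bsub>B\<^esub> (e \<odot>\<^bsub>B\<^esub> b) = \<zero>\<^bsub>B\<^esub>"
        by simp
      have v: "v = y \<oplus>\<^bsub>W\<^esub> \<phi> r \<odot>\<^bsub>W\<^esub> c"
        using 1(4,6) c \<phi>W by simp
      from \<phi>[OF 1(4)] show "v = \<zero>\<^bsub>W\<^esub>"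
      proof
        assume 0: "\<phi> r = \<zero>\<^bsub>R\<^esub>"
        then have "e \<odot>\<^bsub>B\<^esub> x = \<zero>\<^bsub>B\<^esub>"
          using eq ex by simp
        then have "y = \<zero>\<^bsub>W\<^esub>"
          using Gex Gzero Guniq by metis
        then show ?thesis
          using v 0 c by simp
      next
        assume u: "\<phi> r \<in> Units R"
        \<comment> \<open>The relation is solved for \<open>e b\<close>: it equals \<open>s\<close>
          times \<open>e x\<close> with \<open>s\<close> the negated inverse of
          \<open>\<phi> r\<close>. Hence \<open>e b\<close> lies in the domain of \<open>G\<close>,
          and the choice of \<open>c\<close> forces \<open>c\<close> to be \<open>s\<close> times
          \<open>y\<close>.\<close>
        define s where "s = inv\<^bsub>R\<^esub> (\<phi> r) \<otimes>\<^bsub>R\<^esub> \<ominus>\<^bsub>R\<^esub> \<one>\<^bsub>R\<^esub>"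
        have s: "s \<in> carrier R"
          using u by (simp add: s_def)
        have "\<phi> r \<odot>\<^bsub>B\<^esub> (e \<odot>\<^bsub>B\<^esub> b) = \<ominus>\<^bsub>B\<^esub> (e \<odot>\<^bsub>B\<^esub> x)"
          using eq ex \<phi>r B.M.minus_equality B.M.a_comm by (metis B.smult_closed)
        then have "\<phi> r \<odot>\<^bsub>B\<^esub> (e \<odot>\<^bsub>B\<^esub> b) = (\<ominus>\<^bsub>R\<^esub> \<one>\<^bsub>R\<^esub>) \<odot>\<^bsub>B\<^esub> (e \<odot>\<^bsub>B\<^esub> x)"
          using ex by (simp add: B.smult_minus_one)
        then have "inv\<^bsub>R\<^esub> (\<phi> r) \<odot>\<^bsub>B\<^esub> (\<phi> r \<odot>\<^bsub>B\<^esub> (e \<odot>\<^bsub>B\<^esub> b)) = s \<odot>\<^bsub>B\<^esub> (e \<odot>\<^bsub>B\<^esub> x)"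
          using ex u by (simp add: s_def B.smult_assoc1)
        then have "e \<odot>\<^bsub>B\<^esub> b = s \<odot>\<^bsub>B\<^esub> (e \<odot>\<^bsub>B\<^esub> x)"
          using ex u \<phi>r by (simp add: B.smult_assoc1[symmetric])
        then have "s \<odot>\<^bsub>W\<^esub> y = c"
          using Gc Gsm[OF s Gex] by simp
        then have "\<phi> r \<odot>\<^bsub>W\<^esub> c = (\<phi> r \<otimes>\<^bsub>R\<^esub> s) \<odot>\<^bsub>W\<^esub> y"
          using s \<phi>r 1(3) by (simp add: W.smult_assoc1)
        also have "\<phi> r \<otimes>\<^bsub>R\<^esub> s = \<ominus>\<^bsub>R\<^esub> \<one>\<^bsub>R\<^esub>"
          using u \<phi>r by (simp add: s_def B.R.m_assoc[symmetric])
        finally show ?thesis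
          using v 1(3) by (simp add: W.smult_minus_one W.M.r_neg)
      qed
    qed
  qed
  ultimately show "\<exists>G'. hom_graph R B W G' \<and> G \<subseteq> G' \<and> b \<in> fst ` G'"
    by force
qed

section \<open>Ind and the projection onto the algebra of the group of units\<close>

section \<open>Induction from the group of units\<close>

context finite_monoid_algebra
begin

lemma supported_one_Units:
  assumes a: "a \<in> carrier KM" and supp: "\<And>y. y \<noteq> \<one>\<^bsub>M\<^esub> \<Longrightarrow> a y = \<zero>\<^bsub>K\<^esub>"
    and unit: "a \<one>\<^bsub>M\<^esub> \<in> Units K"
  shows "a \<in> Units KM"
proof -
  define u where "u y = (if y = \<one>\<^bsub>M\<^esub> then inv\<^bsub>K\<^esub> (a \<one>\<^bsub>M\<^esub>) else \<zero>\<^bsub>K\<^esub>)" for y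
  have u: "u \<in> carrier KM"
    using unit unfolding carrier_iff by (auto simp: u_def)
  have "(u \<otimes>\<^bsub>KM\<^esub> a) x = \<one>\<^bsub>KM\<^esub> x" for x
    using unit a supp by (subst mult_supported_one[OF u a]) (auto simp: u_def one_apply)
  moreover have "(a \<otimes>\<^bsub>KM\<^esub> u) x = \<one>\<^bsub>KM\<^esub> x" for x
    using unit coeff_closed[OF a] by (subst mult_supported_one[OF a u supp]) (auto simp: u_def one_apply)
  ultimately show ?thesis
    using a u unfolding Units_def by auto
qed

text \<open>The assumption says that the nonunits form a two-sided ideal of \<open>M\<close>. They
  then span an ideal of kM, and deleting their coefficients is the quotient map, with kG as the
  quotient.\<close>

lemma units_restriction_ring_hom:
  assumes nonunits: "\<And>x y. \<lbrakk>x \<in> carrier M; y \<in> carrier M; x \<otimes>\<^bsub>M\<^esub> y \<in> Units M\<rbrakk> \<Longrightarrow>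
    x \<in> Units M \<and> y \<in> Units M"
  shows "(\<lambda>a x. if x \<in> Units M then a x else \<zero>\<^bsub>K\<^esub>) \<in> ring_hom KM (monoid_algebra K (units_of M))"
proof -
  interpret G: finite_monoid_algebra K "units_of M"
    by (intro finite_monoid_algebra.intro finite_monoid_algebra_axioms.intro K.ring_axioms
        group.is_monoid[OF M.units_group])
       (auto simp: units_of_carrier intro: finite_subset[OF _ finite_carrier])
  let ?\<rho> = "\<lambda>a x. if x \<in> Units M then a x else \<zero>\<^bsub>K\<^esub>"
  have \<rho>: "?\<rho> a \<in> carrier G.KM" if "a \<in> carrier KM" for a
    using coeff_closed[OF that] by (auto simp: G.carrier_iff units_of_carrier)
  show ?thesis
  proof (rule ring_hom_memI)
    fix a b assume a: "a \<in> carrier KM" and b: "b \<in> carrier KM"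
    note [simp] = coeff_closed[OF a] coeff_closed[OF b]
    show "?\<rho> (a \<otimes>\<^bsub>KM\<^esub> b) = ?\<rho> a \<otimes>\<^bsub>G.KM\<^esub> ?\<rho> b"
    proof
      fix x
      let ?t = "\<lambda>y z. if y \<otimes>\<^bsub>M\<^esub> z = x then a y \<otimes>\<^bsub>K\<^esub> b z else \<zero>\<^bsub>K\<^esub>"
      have G: "(?\<rho> a \<otimes>\<^bsub>G.KM\<^esub> ?\<rho> b) x = (\<Oplus>\<^bsub>K\<^esub>y\<in>Units M. \<Oplus>\<^bsub>K\<^esub>z\<in>Units M. ?t y z)"
        unfolding G.mult_eq[OF \<rho>[OF a] \<rho>[OF b]]
        by (auto simp: units_of_carrier units_of_mult intro!: K.finsum_cong' K.finsum_closed)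
      show "?\<rho> (a \<otimes>\<^bsub>KM\<^esub> b) x = (?\<rho> a \<otimes>\<^bsub>G.KM\<^esub> ?\<rho> b) x"
      proof (cases "x \<in> Units M")
        case True
        have zero: "?t y z = \<zero>\<^bsub>K\<^esub>"
          if "y \<in> carrier M" "z \<in> carrier M" "y \<notin> Units M \<or> z \<notin> Units M" for y z
          using True nonunits[OF that(1,2)] that(3) by auto
        have sub: "Units M \<subseteq> carrier M"
          by auto
        have c: "?t y z \<in> carrier K" for y z
          by simp
        have "(\<Oplus>\<^bsub>K\<^esub>z\<in>Units M. ?t y z) = (\<Oplus>\<^bsub>K\<^esub>z\<in>carrier M. ?t y z)" if "y \<in> Units M" for y
          using that c zero[of y] sub
          by (intro K.add.finprod_mono_neutral_cong_left finite_carrier Pi_I) blast+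
        then have "(\<Oplus>\<^bsub>K\<^esub>y\<in>Units M. \<Oplus>\<^bsub>K\<^esub>z\<in>Units M. ?t y z) =
          (\<Oplus>\<^bsub>K\<^esub>y\<in>Units M. \<Oplus>\<^bsub>K\<^esub>z\<in>carrier M. ?t y z)"
          using c by (intro K.finsum_cong'[OF refl] Pi_I K.finsum_closed) blast+
        also have "\<dots> = (\<Oplus>\<^bsub>K\<^esub>y\<in>carrier M. \<Oplus>\<^bsub>K\<^esub>z\<in>carrier M. ?t y z)"
        proof (rule K.add.finprod_mono_neutral_cong_left[OF finite_carrier sub])
          show "(\<Oplus>\<^bsub>K\<^esub>z\<in>carrier M. ?t y z) = \<zero>\<^bsub>K\<^esub>" if "y \<in> carrier M - Units M" for y
            using that zero by (intro K.add.finprod_one_eqI) blast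
        qed (auto intro!: K.finsum_closed)
        finally show ?thesis
          unfolding G using True by (simp add: mult_eq[OF a b])
      next
        case False
        \<comment> \<open>Products of units are units, so on the group side no pair reaches a
          nonunit \<open>x\<close>.\<close>
        then show ?thesis
          unfolding G by (auto intro!: K.add.finprod_one_eqI[symmetric] K.add.finprod_one_eqI)
      qed
    qed
  qed (auto simp: \<rho> fun_eq_iff add_apply G.add_apply one_apply G.one_apply units_of_one)
qed

lemma Ind_left_module:
  assumes "left_module (monoid_algebra K (units_of M)) W"
    and "\<And>x y. \<lbrakk>x \<in> carrier M; y \<in> carrier M; x \<otimes>\<^bsub>M\<^esub> y \<in> Units M\<rbrakk> \<Longrightarrow>
      x \<in> Units M \<and> y \<in> Units M"
  shows "left_module KM (Ind K M W)"
  unfolding Ind_def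
  by (rule left_module_restrict_scalars[OF monoid_algebra_ring assms(1)
      units_restriction_ring_hom[OF assms(2)]])

end

section \<open>The Catalan monoid: trivial units and omitted values\<close>

section \<open>The Catalan monoid\<close>

lemma catalan_monoid_simps:
  "f \<in> carrier (catalan_monoid m) \<longleftrightarrow>
    f \<in> {1..m} \<rightarrow>\<^sub>E {1..m} \<and> mono_on {1..m} f \<and> (\<forall>x\<in>{1..m}. x \<le> f x)"
  "f \<otimes>\<^bsub>catalan_monoid m\<^esub> g = compose {1..m} f g"
  "\<one>\<^bsub>catalan_monoid m\<^esub> = (\<lambda>x\<in>{1..m}. x)"
  by (simp_all add: catalan_monoid_def)

lemma catalan_monoidD:
  assumes "f \<in> carrier (catalan_monoid m)"
  shows "x \<in> {1..m} \<Longrightarrow> f x \<in> {1..m}"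
    and "x \<in> {1..m} \<Longrightarrow> x \<le> f x"
    and "\<lbrakk>x \<in> {1..m}; y \<in> {1..m}; x \<le> y\<rbrakk> \<Longrightarrow> f x \<le> f y"
    and "x \<notin> {1..m} \<Longrightarrow> f x = undefined"
proof -
  have f: "f \<in> {1..m} \<rightarrow>\<^sub>E {1..m}" "mono_on {1..m} f" "\<forall>x\<in>{1..m}. x \<le> f x"
    using assms unfolding catalan_monoid_simps(1) by blast+
  show "x \<in> {1..m} \<Longrightarrow> f x \<in> {1..m}" "x \<notin> {1..m} \<Longrightarrow> f x = undefined"
    using PiE_mem[OF f(1)] PiE_arb[OF f(1)] by blast+
  show "x \<in> {1..m} \<Longrightarrow> x \<le> f x"
    using f(3) by blast
  show "\<lbrakk>x \<in> {1..m}; y \<in> {1..m}; x \<le> y\<rbrakk> \<Longrightarrow> f x \<le> f y"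
    using f(2) by (rule mono_onD)
qed

lemma catalan_monoid_monoid: "monoid (catalan_monoid m)"
proof (rule monoidI)
  fix f g assume f: "f \<in> carrier (catalan_monoid m)" and g: "g \<in> carrier (catalan_monoid m)"
  have "x \<le> f (g x)" if "x \<in> {1..m}" for x
    using catalan_monoidD(1,2)[OF g that] catalan_monoidD(2)[OF f, of "g x"] by simp
  moreover have "f (g x) \<le> f (g y)" if "x \<in> {1..m}" "y \<in> {1..m}" "x \<le> y" for x y
    by (rule catalan_monoidD(3)[OF f catalan_monoidD(1)[OF g that(1)]
        catalan_monoidD(1)[OF g that(2)] catalan_monoidD(3)[OF g that]])
  moreover have "f (g x) \<in> {1..m}" if "x \<in> {1..m}" for x
    by (rule catalan_monoidD(1)[OF f catalan_monoidD(1)[OF g that]])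
  ultimately show "f \<otimes>\<^bsub>catalan_monoid m\<^esub> g \<in> carrier (catalan_monoid m)"
    by (auto simp: catalan_monoid_simps compose_def intro!: mono_onI)
next
  fix f g h assume "h \<in> carrier (catalan_monoid m)"
  from catalan_monoidD(1)[OF this] show "f \<otimes>\<^bsub>catalan_monoid m\<^esub> g \<otimes>\<^bsub>catalan_monoid m\<^esub> h =
      f \<otimes>\<^bsub>catalan_monoid m\<^esub> (g \<otimes>\<^bsub>catalan_monoid m\<^esub> h)"
    by (auto simp: catalan_monoid_simps compose_def fun_eq_iff)
next
  fix f assume f: "f \<in> carrier (catalan_monoid m)"
  show "\<one>\<^bsub>catalan_monoid m\<^esub> \<otimes>\<^bsub>catalan_monoid m\<^esub> f = f"
    using catalan_monoidD(1,4)[OF f]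
    by (simp add: catalan_monoid_simps(2,3) compose_def restrict_def fun_eq_iff)
  show "f \<otimes>\<^bsub>catalan_monoid m\<^esub> \<one>\<^bsub>catalan_monoid m\<^esub> = f"
    using catalan_monoidD(1,4)[OF f]
    by (simp add: catalan_monoid_simps(2,3) compose_def restrict_def fun_eq_iff)
qed (auto simp: catalan_monoid_simps intro!: mono_onI)

lemma finite_catalan_monoid: "finite (carrier (catalan_monoid m))"
  by (rule finite_subset[of _ "{1..m} \<rightarrow>\<^sub>E {1..m}"])
     (auto simp only: catalan_monoid_simps(1) intro!: finite_PiE)

text \<open>No map lowers a point, so x \<le> g x \<le> f (g x) = x squeezes \<open>g\<close> to the
  identity, and \<open>f\<close> follows.\<close>

lemma catalan_monoid_mult_eq_one:
  assumes f: "f \<in> carrier (catalan_monoid m)" and g: "g \<in> carrier (catalan_monoid m)"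
    and fg: "f \<otimes>\<^bsub>catalan_monoid m\<^esub> g = \<one>\<^bsub>catalan_monoid m\<^esub>"
  shows "f = \<one>\<^bsub>catalan_monoid m\<^esub> \<and> g = \<one>\<^bsub>catalan_monoid m\<^esub>"
proof -
  have gx: "g x = x" if "x \<in> {1..m}" for x
  proof -
    have "f (g x) = x"
      using fun_cong[OF fg, of x] that by (simp add: catalan_monoid_simps(2,3) compose_def)
    then show ?thesis
      using catalan_monoidD(1,2)[OF g that] catalan_monoidD(2)[OF f, of "g x"] by simp
  qed
  then have "g = \<one>\<^bsub>catalan_monoid m\<^esub>"
    using catalan_monoidD(4)[OF g] by (auto simp: catalan_monoid_simps(3) restrict_def)
  then show ?thesis
    using fg f monoid.r_one[OF catalan_monoid_monoid] by simp
qed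

lemma Units_catalan_monoid: "Units (catalan_monoid m) = {\<one>\<^bsub>catalan_monoid m\<^esub>}"
  using catalan_monoid_mult_eq_one monoid.Units_one_closed[OF catalan_monoid_monoid]
  by (auto simp: Units_def)

text \<open>The least moved point \<open>j\<close> is omitted: smaller points are fixed and stay
  below \<open>j\<close>, and from \<open>j\<close> on all values are at least \<open>z j\<close>,
  which exceeds \<open>j\<close>. It differs from \<open>m\<close> because \<open>m\<close> has
  nowhere to go.\<close>

lemma catalan_monoid_omits:
  assumes z: "z \<in> carrier (catalan_monoid m)" and "z \<noteq> \<one>\<^bsub>catalan_monoid m\<^esub>"
  obtains j where "j \<in> {1..<m}" "j \<notin> z ` {1..m}"
proof -
  define j where "j = (LEAST x. x \<in> {1..m} \<and> z x \<noteq> x)"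
  have "\<exists>x. x \<in> {1..m} \<and> z x \<noteq> x"
    using assms(2) catalan_monoidD(4)[OF z] by (auto simp: catalan_monoid_simps(3) restrict_def)
  then have j: "j \<in> {1..m}" "z j \<noteq> j"
    unfolding j_def by (metis (mono_tags, lifting) LeastI)+
  have le: "x \<le> z x" "z x \<le> m" if "x \<in> {1..m}" for x
    using catalan_monoidD(1,2)[OF z that] by auto
  have "j < z j" "j \<noteq> m"
    using j le[of j] by auto
  moreover have "j \<noteq> z x" if x: "x \<in> {1..m}" for x
  proof (cases "x < j")
    case True
    then show ?thesis
      using not_less_Least[of x "\<lambda>x. x \<in> {1..m} \<and> z x \<noteq> x"] x unfolding j_def by auto
  next
    case False
    then have "z j \<le> z x"
      using catalan_monoidD(3)[OF z j(1) x] by simp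
    then show ?thesis
      using \<open>j < z j\<close> by simp
  qed
  ultimately have "j \<in> {1..<m}" "j \<notin> z ` {1..m}"
    using j(1) by (simp, blast)
  then show ?thesis
    by (rule that)
qed

section \<open>The signed sum e and its annihilation of nonidentity maps\<close>

text \<open>The expansion of \<open>(1 - g\<^sub>1) (1 - g\<^sub>2) \<cdots> (1 - g\<^sub>m\<^sub>-\<^sub>1)\<close>, where \<open>g\<^sub>i\<close> moves only \<open>i\<close>, to \<open>i + 1\<close>.\<close>

definition catalan_idempotent ::
  "('k, 's) ring_scheme \<Rightarrow> nat \<Rightarrow> (nat \<Rightarrow> nat) \<Rightarrow> 'k"
  where "catalan_idempotent K m f =
    (if f \<in> carrier (catalan_monoid m) \<and> (\<forall>x\<in>{1..m}. f x \<le> Suc x)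
     then (\<ominus>\<^bsub>K\<^esub> \<one>\<^bsub>K\<^esub>) [^]\<^bsub>K\<^esub> card {x \<in> {1..m}. f x \<noteq> x} else \<zero>\<^bsub>K\<^esub>)"

text \<open>Monotonicity comes for free when every value at x is x or x + 1: for a < b the value at
  a is at most a + 1 \<le> b, hence at most the value at b. So single values can be changed
  independently of each other.\<close>

lemma catalan_monoid_update:
  assumes y: "y \<in> carrier (catalan_monoid m)" "\<forall>x\<in>{1..m}. y x \<le> Suc x"
    and j: "j \<in> {1..m}" and k: "j \<le> k" "k \<le> Suc j" "k \<le> m"
  shows "y(j := k) \<in> carrier (catalan_monoid m)"
proof -
  have bounds: "x \<le> (y(j := k)) x" "(y(j := k)) x \<le> Suc x" if "x \<in> {1..m}" for x
    using catalan_monoidD(2)[OF y(1) that] y(2) k that by auto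
  have "(y(j := k)) a \<le> (y(j := k)) b" if "a \<in> {1..m}" "b \<in> {1..m}" "a \<le> b" for a b
    using bounds[OF that(1)] bounds[OF that(2)] that(3) by (cases "a = b") auto
  then show ?thesis
    using y(1) j k bounds
    by (auto simp: catalan_monoid_simps PiE_iff extensional_def intro!: mono_onI)
qed

text \<open>Raising a fixed \<open>j\<close> adds exactly one moved point; \<open>j < m\<close>
  keeps the new value in range.\<close>

lemma catalan_idempotent_toggle:
  assumes "ring K" and y: "y \<in> carrier (catalan_monoid m)" "\<forall>x\<in>{1..m}. y x \<le> Suc x"
    and j: "j \<in> {1..<m}" "y j = j"
  shows "y(j := Suc j) \<in> carrier (catalan_monoid m)"
    and "catalan_idempotent K m (y(j := Suc j)) = \<ominus>\<^bsub>K\<^esub> catalan_idempotent K m y"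
proof -
  interpret K: ring K by fact
  let ?y = "y(j := Suc j)"
  show c: "?y \<in> carrier (catalan_monoid m)"
    using j by (intro catalan_monoid_update[OF y]) auto
  have near: "\<forall>x\<in>{1..m}. ?y x \<le> Suc x"
    using y(2) by simp
  have "{x \<in> {1..m}. ?y x \<noteq> x} = insert j {x \<in> {1..m}. y x \<noteq> x}"
    using j by auto
  moreover have "j \<notin> {x \<in> {1..m}. y x \<noteq> x}"
    using j by auto
  ultimately have card: "card {x \<in> {1..m}. ?y x \<noteq> x} = Suc (card {x \<in> {1..m}. y x \<noteq> x})"
    by simp
  show "catalan_idempotent K m ?y = \<ominus>\<^bsub>K\<^esub> catalan_idempotent K m y"
    using c y near unfolding catalan_idempotent_def card by (simp add: K.r_minus)
qed

text \<open>The sum is the coefficient at \<open>x\<close> of the signed sum times the basis element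
  \<open>z\<close>; the annihilation is thus proved one coefficient at a time.\<close>

lemma finsum_catalan_idempotent_mult:
  assumes "ring K" and z: "z \<in> carrier (catalan_monoid m)" "z \<noteq> \<one>\<^bsub>catalan_monoid m\<^esub>"
  shows "(\<Oplus>\<^bsub>K\<^esub>y\<in>carrier (catalan_monoid m).
    if y \<otimes>\<^bsub>catalan_monoid m\<^esub> z = x then catalan_idempotent K m y else \<zero>\<^bsub>K\<^esub>) = \<zero>\<^bsub>K\<^esub>"
proof -
  interpret K: ring K by fact
  obtain j where j: "j \<in> {1..<m}" "j \<notin> z ` {1..m}"
    using catalan_monoid_omits[OF z] .
  let ?E = "catalan_idempotent K m" and ?C = "carrier (catalan_monoid m)"
  have E: "?E y \<in> carrier K" for y
    by (simp add: catalan_idempotent_def)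
  \<comment> \<open>Outside \<open>D\<close> a summand is zero, by the product condition or because
    the signed sum vanishes there. Within \<open>D\<close>, the set \<open>D0\<close> holds the
    lower partner of each cancelling pair.\<close>
  define D where "D = {y \<in> ?C. (\<forall>x\<in>{1..m}. y x \<le> Suc x) \<and> y \<otimes>\<^bsub>catalan_monoid m\<^esub> z = x}"
  define D0 where "D0 = {y \<in> D. y j = j}"
  have fin: "finite D" "finite D0"
    unfolding D0_def D_def by (auto intro: finite_subset[OF _ finite_catalan_monoid])
  have upd: "compose {1..m} (y(j := k)) z = compose {1..m} y z" for y k
    using j(2) by (auto simp: compose_def fun_eq_iff)
  have jm: "j \<in> {1..m}"
    using j(1) by auto
  have D1: "{y \<in> D. y j \<noteq> j} = (\<lambda>y. y(j := Suc j)) ` D0"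
  proof (intro equalityI subsetI)
    fix y assume y: "y \<in> {y \<in> D. y j \<noteq> j}"
    then have yD: "y \<in> ?C" "\<And>x. x \<in> {1..m} \<Longrightarrow> x \<le> y x" "\<forall>x\<in>{1..m}. y x \<le> Suc x"
      "compose {1..m} y z = x"
      using catalan_monoidD(2) by (auto simp: D_def catalan_monoid_simps(2))
    then have "y j = Suc j"
      using y jm by (metis (mono_tags, lifting) mem_Collect_eq le_SucE le_antisym)
    \<comment> \<open>Resetting the value at \<open>j\<close> undoes the toggle.\<close>
    let ?y = "y(j := j)"
    have "?y \<in> ?C"
      using jm by (intro catalan_monoid_update[OF yD(1,3)]) auto
    then have "?y \<in> D0"
      using yD(3,4) upd by (auto simp: D0_def D_def catalan_monoid_simps(2))
    moreover have "y = ?y(j := Suc j)"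
      using \<open>y j = Suc j\<close> by auto
    ultimately show "y \<in> (\<lambda>y. y(j := Suc j)) ` D0"
      by (intro image_eqI[of y _ ?y])
  next
    fix y assume "y \<in> (\<lambda>y. y(j := Suc j)) ` D0"
    then obtain w where w: "w \<in> ?C" "\<forall>x\<in>{1..m}. w x \<le> Suc x" "w j = j"
      "compose {1..m} w z = x" "y = w(j := Suc j)"
      by (auto simp: D0_def D_def catalan_monoid_simps(2))
    then show "y \<in> {y \<in> D. y j \<noteq> j}"
      using catalan_idempotent_toggle(1)[OF assms(1) w(1,2) j(1) w(3)] upd
      by (auto simp: D_def catalan_monoid_simps(2))
  qed
  \<comment> \<open>Members of \<open>D0\<close> agree at \<open>j\<close>, so overwriting that
    value loses no information.\<close>
  have inj: "inj_on (\<lambda>y. y(j := Suc j)) D0"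
    by (rule inj_onI) (metis (mono_tags, lifting) D0_def fun_upd_triv fun_upd_upd mem_Collect_eq)
  have "(\<Oplus>\<^bsub>K\<^esub>y\<in>?C. if y \<otimes>\<^bsub>catalan_monoid m\<^esub> z = x then ?E y else \<zero>\<^bsub>K\<^esub>) = (\<Oplus>\<^bsub>K\<^esub>y\<in>D. ?E y)"
    using E by (intro K.add.finprod_mono_neutral_cong_right finite_catalan_monoid)
      (auto simp: D_def catalan_idempotent_def)
  also have "D = D0 \<union> (\<lambda>y. y(j := Suc j)) ` D0"
    unfolding D1[symmetric] by (auto simp: D0_def)
  also have "(\<Oplus>\<^bsub>K\<^esub>y\<in>D0 \<union> (\<lambda>y. y(j := Suc j)) ` D0. ?E y) =
      (\<Oplus>\<^bsub>K\<^esub>y\<in>D0. ?E y) \<oplus>\<^bsub>K\<^esub> (\<Oplus>\<^bsub>K\<^esub>y\<in>(\<lambda>y. y(j := Suc j)) ` D0. ?E y)"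
    using E fin by (intro K.finsum_Un_disjoint) (auto simp: D0_def)
  also have "(\<Oplus>\<^bsub>K\<^esub>y\<in>(\<lambda>y. y(j := Suc j)) ` D0. ?E y) = (\<Oplus>\<^bsub>K\<^esub>y\<in>D0. ?E (y(j := Suc j)))"
    using E inj by (intro K.finsum_reindex) auto
  also have "\<dots> = (\<Oplus>\<^bsub>K\<^esub>y\<in>D0. \<ominus>\<^bsub>K\<^esub> ?E y)"
    using E catalan_idempotent_toggle(2)[OF assms(1) _ _ j(1)]
    by (intro K.finsum_cong') (auto simp: D0_def D_def)
  also have "(\<Oplus>\<^bsub>K\<^esub>y\<in>D0. ?E y) \<oplus>\<^bsub>K\<^esub> \<dots> = (\<Oplus>\<^bsub>K\<^esub>y\<in>D0. ?E y \<oplus>\<^bsub>K\<^esub> \<ominus>\<^bsub>K\<^esub> ?E y)"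
    using E by (intro K.finsum_addf[symmetric]) auto
  also have "\<dots> = \<zero>\<^bsub>K\<^esub>"
    using E by (intro K.add.finprod_one_eqI) (simp add: K.r_neg)
  finally show ?thesis .
qed

text \<open>With the sum over the right factor \<open>z\<close> outside, every \<open>z\<close>
  other than the identity contributes zero. The coefficients lie in an arbitrary ring, so the scalar
  stands on the right; commutativity moves it to the left once \<open>K\<close> is a field.\<close>

lemma catalan_idempotent_absorbs:
  assumes "ring K" and a: "a \<in> carrier (monoid_algebra K (catalan_monoid m))"
  shows "(catalan_idempotent K m \<otimes>\<^bsub>monoid_algebra K (catalan_monoid m)\<^esub> a) x =
    catalan_idempotent K m x \<otimes>\<^bsub>K\<^esub> a \<one>\<^bsub>catalan_monoid m\<^esub>"
proof -
  let ?M = "catalan_monoid m"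
  let ?E = "catalan_idempotent K m"
  interpret finite_monoid_algebra K ?M
    by (intro finite_monoid_algebra.intro finite_monoid_algebra_axioms.intro assms(1)
        catalan_monoid_monoid finite_catalan_monoid)
  note [simp] = coeff_closed[OF a]
  have E: "?E \<in> carrier KM" and [simp]: "?E y \<in> carrier K" for y
    unfolding carrier_iff by (auto simp: catalan_idempotent_def)
  have "(?E \<otimes>\<^bsub>KM\<^esub> a) x = (\<Oplus>\<^bsub>K\<^esub>z\<in>carrier ?M. \<Oplus>\<^bsub>K\<^esub>y\<in>carrier ?M.
      ?E y \<otimes>\<^bsub>K\<^esub> (if y \<otimes>\<^bsub>?M\<^esub> z = x then a z else \<zero>\<^bsub>K\<^esub>))"
    by (rule mult_eq_pairing_left[OF E a])
  also have "\<dots> = (\<Oplus>\<^bsub>K\<^esub>z\<in>carrier ?M. if \<one>\<^bsub>?M\<^esub> = z then ?E x \<otimes>\<^bsub>K\<^esub> a z else \<zero>\<^bsub>K\<^esub>)"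
  proof (intro K.finsum_cong' refl)
    fix z assume z: "z \<in> carrier ?M"
    have "(\<Oplus>\<^bsub>K\<^esub>y\<in>carrier ?M. ?E y \<otimes>\<^bsub>K\<^esub> (if y \<otimes>\<^bsub>?M\<^esub> z = x then a z else \<zero>\<^bsub>K\<^esub>)) =
      (\<Oplus>\<^bsub>K\<^esub>y\<in>carrier ?M. (if y \<otimes>\<^bsub>?M\<^esub> z = x then ?E y else \<zero>\<^bsub>K\<^esub>) \<otimes>\<^bsub>K\<^esub> a z)"
      by (intro K.finsum_cong' refl) auto
    also have "\<dots> = (\<Oplus>\<^bsub>K\<^esub>y\<in>carrier ?M. if y \<otimes>\<^bsub>?M\<^esub> z = x then ?E y else \<zero>\<^bsub>K\<^esub>) \<otimes>\<^bsub>K\<^esub> a z"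
      by (intro K.finsum_ldistr[symmetric] finite_carrier) auto
    also have "\<dots> = (if \<one>\<^bsub>?M\<^esub> = z then ?E x \<otimes>\<^bsub>K\<^esub> a z else \<zero>\<^bsub>K\<^esub>)"
    proof (cases "z = \<one>\<^bsub>?M\<^esub>")
      case True
      have "(\<Oplus>\<^bsub>K\<^esub>y\<in>carrier ?M. if y \<otimes>\<^bsub>?M\<^esub> z = x then ?E y else \<zero>\<^bsub>K\<^esub>) =
        (\<Oplus>\<^bsub>K\<^esub>y\<in>carrier ?M. if x = y then ?E y else \<zero>\<^bsub>K\<^esub>)"
        unfolding True by (intro K.finsum_cong' refl) auto
      also have "\<dots> = ?E x"
        by (rule finsum_delta[OF E])
      finally show ?thesis
        using True by simp
    qed (use finsum_catalan_idempotent_mult[OF assms(1) z] in auto)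
    finally show "(\<Oplus>\<^bsub>K\<^esub>y\<in>carrier ?M. ?E y \<otimes>\<^bsub>K\<^esub> (if y \<otimes>\<^bsub>?M\<^esub> z = x then a z else \<zero>\<^bsub>K\<^esub>)) =
      (if \<one>\<^bsub>?M\<^esub> = z then ?E x \<otimes>\<^bsub>K\<^esub> a z else \<zero>\<^bsub>K\<^esub>)" .
  qed auto
  also have "\<dots> = ?E x \<otimes>\<^bsub>K\<^esub> a \<one>\<^bsub>?M\<^esub>"
    using finite_carrier by (intro K.finsum_singleton) auto
  finally show ?thesis .
qed

section \<open>The group-injective condition for the Catalan monoid\<close>

theorem proposition3p2p10:
  fixes K :: "('k, 's) ring_scheme" and m :: nat
  assumes "m \<ge> 1" and "algebraically_closed K"
  shows "group_injective K (catalan_monoid m)"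
proof -
  let ?M = "catalan_monoid m"
  let ?A = "monoid_algebra K ?M" and ?G = "monoid_algebra K (units_of ?M)"
  \<comment> \<open>As the group of units is trivial, \<open>?G\<close> is a copy of
    \<open>K\<close>, and its regular module is a projective indecomposable.\<close>
  let ?P = "ideal_as_module ?G (carrier ?G)"
  \<comment> \<open>With the identity as the only unit, this is a(1) times the identity. The same
    function is the projection inside \<open>Ind\<close> and the scalar required by the injectivity
    criterion.\<close>
  let ?\<phi> = "\<lambda>a x. if x \<in> Units ?M then a x else \<zero>\<^bsub>K\<^esub>"
  let ?e = "catalan_idempotent K m"
  interpret K: algebraically_closed K by fact
  interpret A: finite_monoid_algebra K ?M
    by (intro finite_monoid_algebra.intro finite_monoid_algebra_axioms.intro K.ring_axioms
        catalan_monoid_monoid finite_catalan_monoid)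
  interpret G: finite_monoid_algebra K "units_of ?M"
    by (intro finite_monoid_algebra.intro finite_monoid_algebra_axioms.intro K.ring_axioms
        group.is_monoid[OF A.M.units_group])
       (simp add: units_of_carrier Units_catalan_monoid)
  have G_supp: "a y = \<zero>\<^bsub>K\<^esub>" if "a \<in> carrier ?G" "y \<noteq> \<one>\<^bsub>?M\<^esub>" for a y
    using that by (auto simp: G.carrier_iff units_of_carrier Units_catalan_monoid)
  have G_units: "a \<in> Units ?G" if a: "a \<in> carrier ?G" "a \<noteq> \<zero>\<^bsub>?G\<^esub>" for a
  proof -
    have "a \<one>\<^bsub>?M\<^esub> \<noteq> \<zero>\<^bsub>K\<^esub>"
      using a G_supp[OF a(1)] by (metis G.zero_apply ext)
    then show ?thesis
      using a(1) G_supp[OF a(1)] G.coeff_closed[OF a(1)]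
      by (intro G.supported_one_Units) (auto simp: units_of_one K.field_Units)
  qed
  have P: "left_module ?G ?P"
    by (rule regular_module_left_module[OF G.monoid_algebra_ring])
  have "\<one>\<^bsub>?G\<^esub> \<one>\<^bsub>?M\<^esub> \<noteq> \<zero>\<^bsub>?G\<^esub> \<one>\<^bsub>?M\<^esub>"
    by (simp add: G.one_apply G.zero_apply units_of_one)
  then have "\<one>\<^bsub>?G\<^esub> \<noteq> \<zero>\<^bsub>?G\<^esub>"
    by metis
  then have "indecomposable_module ?G ?P"
    using G_units by (intro regular_module_indecomposable G.monoid_algebra_ring)
  moreover have "injective_module TYPE((nat \<Rightarrow> nat) \<Rightarrow> 'k) TYPE((nat \<Rightarrow> nat) \<Rightarrow> 'k) ?A (Ind K ?M ?P)"
  proof (rule injective_moduleI_absorbing[where e = ?e and \<phi> = ?\<phi>])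
    show "left_module ?A (Ind K ?M ?P)"
    proof (rule A.Ind_left_module[OF P])
      fix x y assume "x \<in> carrier ?M" "y \<in> carrier ?M" "x \<otimes>\<^bsub>?M\<^esub> y \<in> Units ?M"
      then show "x \<in> Units ?M \<and> y \<in> Units ?M"
        using catalan_monoid_mult_eq_one[of x m y] by (simp add: Units_catalan_monoid)
    qed
    show e: "?e \<in> carrier ?A"
      unfolding A.carrier_iff by (auto simp: catalan_idempotent_def)
    \<comment> \<open>The identity moves no point, so its sign is the empty power and
      \<open>?e\<close> restricts to the one of \<open>?G\<close>.\<close>
    have one: "\<one>\<^bsub>?M\<^esub> x = x" if "x \<in> {1..m}" for x
      using that by (simp add: catalan_monoid_simps(3))
    then have fixed: "{x \<in> {1..m}. \<one>\<^bsub>?M\<^esub> x \<noteq> x} = {}"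
      by blast
    have "?e \<one>\<^bsub>?M\<^esub> = \<one>\<^bsub>K\<^esub>"
      unfolding catalan_idempotent_def fixed using A.M.one_closed one by simp
    then have "?\<phi> ?e = \<one>\<^bsub>?G\<^esub>"
      by (intro ext) (simp add: G.one_apply units_of_one Units_catalan_monoid)
    then show "?e \<odot>\<^bsub>Ind K ?M ?P\<^esub> w = w" if "w \<in> carrier (Ind K ?M ?P)" for w
      using that by (simp add: Ind_def ideal_as_module_def G.one_mult)
    fix a assume a: "a \<in> carrier ?A"
    have \<phi>a: "?\<phi> a \<in> carrier ?A"
      using A.coeff_closed[OF a] A.M.Units_closed unfolding A.carrier_iff by auto
    have supp: "?\<phi> a y = \<zero>\<^bsub>K\<^esub>" if "y \<noteq> \<one>\<^bsub>?M\<^esub>" for y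
      using that by (simp add: Units_catalan_monoid)
    show "?\<phi> a = \<zero>\<^bsub>?A\<^esub> \<or> ?\<phi> a \<in> Units ?A"
    proof (cases "a \<one>\<^bsub>?M\<^esub> = \<zero>\<^bsub>K\<^esub>")
      case True
      then have "?\<phi> a = \<zero>\<^bsub>?A\<^esub>"
        by (intro ext) (simp add: A.zero_apply Units_catalan_monoid)
      then show ?thesis ..
    next
      case False
      then have "?\<phi> a \<in> Units ?A"
        using A.coeff_closed[OF a]
        by (intro A.supported_one_Units[OF \<phi>a supp]) (auto simp: K.field_Units)
      then show ?thesis ..
    qed
    \<comment> \<open>At \<open>x\<close> both sides are the product of \<open>?e x\<close> and
      a(1), in opposite orders.\<close>
    show "?e \<otimes>\<^bsub>?A\<^esub> a = ?\<phi> a \<otimes>\<^bsub>?A\<^esub> ?e"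
    proof
      fix x
      show "(?e \<otimes>\<^bsub>?A\<^esub> a) x = (?\<phi> a \<otimes>\<^bsub>?A\<^esub> ?e) x"
        using A.coeff_closed[OF a] A.coeff_closed[OF e]
        by (simp add: catalan_idempotent_absorbs[OF K.ring_axioms a]
            A.mult_supported_one[OF \<phi>a e supp] K.m_comm)
    qed
    \<comment> \<open>Restricting to the units twice is the same as restricting once.\<close>
    show "a \<odot>\<^bsub>Ind K ?M ?P\<^esub> w = ?\<phi> a \<odot>\<^bsub>Ind K ?M ?P\<^esub> w" for w
      by (simp add: Ind_def cong: if_cong)
  qed
  ultimately show ?thesis
    unfolding group_injective_def
    using regular_module_projective[OF G.monoid_algebra_ring] by blast
qed

end
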